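(* Let $\mathbb{K}$ be an algebraically closed field of characteristic $0$ and let $G$ be a finite subgroup of $\operatorname{PGL}_2(\mathbb{K})=\operatorname{Aut}(\mathbb{P}^1)$. Then $\mathrm{coreg}_G(\mathbb{P}^1)=0$ if and only if $G$ is cyclic or dihedral, and otherwise $\mathrm{coreg}_G(\mathbb{P}^1)=1$.
   Context: The dihedral groups are the groups $D_{2n}$ of order $2n$ (the Klein four-group is regarded as dihedral); the trivial group is cyclic. $G$-coregularity. Let $X$ be a normal projective variety over $\mathbb{K}$ with at worst klt singularities and an action of a group $G$. A pair $(X,D)$ consists of $X$ and a $\mathbb{Q}$-divisor $D$ with coefficients in $[0,1]$ such that $K_X+D$ is $\mathbb{Q}$-Cartier; it is a $G$-pair if $D$ is $G$-invariant; lc means log canonical. For an lc pair $(X,D)$ take a log resolution $f\colon Y\to X$, define $D_Y$ by $K_Y+D_Y=f^*(K_X+D)$, and let $D_Y^{=1}$ be the sum of the components of $D_Y$ with coefficient $1$ (a simple normal crossing divisor). The dual complex $\mathcal{D}(X,D)$ is the regular CW complex whose $(k-1)$-dimensional cells correspond to the irreducible components of intersections of $k$ distinct components of $D_Y^{=1}$ ($k\geqslant 1$), glued according to inclusion of strata; up to PL-homeomorphism it does not depend on the log resolution, and $\dim\varnothing=-1$ by convention. Put $\mathrm{reg}_G(X,D)=\dim\mathcal{D}(X,D)$ for an lc $G$-pair; for an integer $l\geqslant 1$ let $\mathrm{reg}_{G,l}(X)$ be the maximum of $\mathrm{reg}_G(X,D)$ over all lc $G$-pairs $(X,D)$ with $D\in\frac1l|-lK_X|$;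 let $\mathrm{reg}_G(X)=\max_{l\geqslant1}\mathrm{reg}_{G,l}(X)$ and $\mathrm{coreg}_G(X)=\dim X-1-\mathrm{reg}_G(X)$. *)

theory Defs
  imports
    "HOL-Analysis.Analysis"
    "HOL-Algebra.Coset"
    "HOL-Algebra.Elementary_Groups"
    "HOL-Computational_Algebra.Polynomial"
    "HOL-Computational_Algebra.Fraction_Field"
begin

section \<open>The groups\<close>

definition GL2 :: "('a::field ^ 2 ^ 2) monoid" where
  "GL2 = \<lparr>carrier = {A. invertible A}, mult = (\<lambda>A B. A ** B), one = mat 1\<rparr>"

definition scalars2 :: "('a::field ^ 2 ^ 2) set" where
  "scalars2 = {mat c | c. c \<noteq> 0}"

definition PGL2 :: "('a::field ^ 2 ^ 2) set monoid" where
  "PGL2 = GL2 Mod scalars2"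

text \<open>The dihedral group of order \<open>2n\<close> as the semidirect product of \<open>\<int>/n\<close> by inversion:
  \<open>(a, e)\<close> is the rotation by \<open>a\<close>, preceded by the basic reflection iff \<open>e\<close> holds.
  For \<open>n = 2\<close> this is the Klein four-group, for \<open>n = 1\<close> the (cyclic) group of order \<open>2\<close>.\<close>

definition dihedral_group :: "nat \<Rightarrow> (int \<times> bool) monoid" where
  "dihedral_group n = \<lparr>carrier = {0..<int n} \<times> UNIV,
     mult = (\<lambda>(a, e) (b, f). ((if e then a - b else a + b) mod int n, e \<noteq> f)),
     one = (0, False)\<rparr>"

definition is_dihedral :: "('g, 'b) monoid_scheme \<Rightarrow> bool" where
  "is_dihedral H \<longleftrightarrow> (\<exists>n\<ge>1. H \<cong> dihedral_group n)"

lemma group_GL2: "group (GL2 :: ('a::field ^ 2 ^ 2) monoid)"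
proof (rule groupI)
  fix A :: "'a ^ 2 ^ 2" assume "A \<in> carrier GL2"
  then obtain B where "A ** B = mat 1" "B ** A = mat 1"
    by (auto simp: GL2_def invertible_def)
  then show "\<exists>B\<in>carrier GL2. B \<otimes>\<^bsub>GL2\<^esub> A = \<one>\<^bsub>GL2\<^esub>"
    by (auto simp: GL2_def invertible_def)
qed (auto simp: GL2_def matrix_mul_assoc invertible_mult invertible_def[of "mat 1"])

lemma normal_scalars2: "(scalars2 :: ('a::field ^ 2 ^ 2) set) \<lhd> GL2"
proof -
  interpret group "GL2 :: ('a ^ 2 ^ 2) monoid" by (rule group_GL2)
  have comm: "mat c ** A = A ** mat c" for c and A :: "'a ^ 2 ^ 2"
    by (simp add: matrix_matrix_mult_def mat_def vec_eq_iff forall_2 sum_2)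
  have mm: "mat c ** mat d = (mat (c * d) :: 'a ^ 2 ^ 2)" for c d
    by (simp add: matrix_matrix_mult_def mat_def vec_eq_iff forall_2 sum_2)
  have inv: "invertible (mat c :: 'a ^ 2 ^ 2)" if "c \<noteq> 0" for c
    unfolding invertible_def using that by (intro exI[of _ "mat (inverse c)"]) (simp add: mm)
  have sub: "subgroup (scalars2 :: ('a ^ 2 ^ 2) set) GL2"
  proof (rule subgroupI)
    show "scalars2 \<subseteq> carrier (GL2 :: ('a ^ 2 ^ 2) monoid)"
      by (auto simp: scalars2_def GL2_def inv)
    show "(scalars2 :: ('a ^ 2 ^ 2) set) \<noteq> {}"
      by (auto simp: scalars2_def intro: exI[of _ 1])
    fix A B :: "'a ^ 2 ^ 2" assume "A \<in> scalars2"
    then obtain c where c: "A = mat c" "c \<noteq> 0" by (auto simp: scalars2_def)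
    have "mat (inverse c) \<otimes>\<^bsub>GL2\<^esub> A = \<one>\<^bsub>GL2\<^esub>"
      using c by (simp add: GL2_def mm)
    then have "inv\<^bsub>GL2\<^esub> A = mat (inverse c)"
      using c by (intro inv_equality) (auto simp: GL2_def inv)
    then show "inv\<^bsub>GL2\<^esub> A \<in> scalars2"
      using c by (auto simp: scalars2_def)
    assume "B \<in> scalars2"
    then show "A \<otimes>\<^bsub>GL2\<^esub> B \<in> scalars2"
      using c by (auto simp: scalars2_def GL2_def mm)
  qed
  show ?thesis
    by (rule normalI[OF sub])
       (auto simp: l_coset_def r_coset_def scalars2_def GL2_def comm)
qed

lemma group_PGL2: "group PGL2"
  unfolding PGL2_def by (rule normal.factorgroup_is_group[OF normal_scalars2])

lemma group_dihedral_group: "n \<ge> 1 \<Longrightarrow> group (dihedral_group n)"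
proof (rule groupI)
  fix x assume "n \<ge> 1" and x: "x \<in> carrier (dihedral_group n)"
  then show "\<exists>y\<in>carrier (dihedral_group n). y \<otimes>\<^bsub>dihedral_group n\<^esub> x = \<one>\<^bsub>dihedral_group n\<^esub>"
    by (intro bexI[of _ "if snd x then x else ((- fst x) mod int n, False)"])
       (auto simp: dihedral_group_def mod_simps)
qed (auto simp: dihedral_group_def mod_simps algebra_simps)


section \<open>The projective line\<close>

typedef (overloaded) 'a proj_line = "{vec.span {v} | v :: 'a::field ^ 2. v \<noteq> 0}"
  morphisms line_of proj_line_of
  by (auto intro: exI[of _ "axis 1 1"])

text \<open>All matrices in a coset \<open>g\<close> map a given line onto the same line.\<close>

definition pgl_act :: "('a::field ^ 2 ^ 2) set \<Rightarrow> 'a proj_line \<Rightarrow> 'a proj_line" where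
  "pgl_act g p = proj_line_of (\<Union>A\<in>g. (\<lambda>v. A *v v) ` line_of p)"

text \<open>The affine coordinate is \<open>x = X / Y\<close> in homogeneous coordinates \<open>[X : Y]\<close>.\<close>

definition pt :: "'a::field \<Rightarrow> 'a proj_line" where
  "pt a = proj_line_of (vec.span {vector [a, 1]})"

definition pt_inf :: "'a::field proj_line" where
  "pt_inf = proj_line_of (vec.span {vector [1, 0]})"

definition affine_coord :: "'a::field proj_line \<Rightarrow> 'a" where
  "affine_coord p = (THE a. p = pt a)"

text \<open>Zariski topology on the closed points: the proper closed subsets of a curve are
  the finite sets of points.\<close>

definition zariski_closed :: "'a::field proj_line set \<Rightarrow> bool" where
  "zariski_closed S \<longleftrightarrow> finite S \<or> S = UNIV"

definition zariski_irreducible :: "'a::field proj_line set \<Rightarrow> bool" where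
  "zariski_irreducible Z \<longleftrightarrow> Z \<noteq> {} \<and>
     (\<forall>A B. zariski_closed A \<and> zariski_closed B \<and> Z \<subseteq> A \<union> B \<longrightarrow> Z \<subseteq> A \<or> Z \<subseteq> B)"

definition irreducible_component_of :: "'a::field proj_line set \<Rightarrow> 'a proj_line set \<Rightarrow> bool" where
  "irreducible_component_of S Z \<longleftrightarrow> Z \<subseteq> S \<and> zariski_irreducible Z \<and>
     (\<forall>Z'. Z \<subseteq> Z' \<and> Z' \<subseteq> S \<and> zariski_irreducible Z' \<longrightarrow> Z' = Z)"


section \<open>Rational functions and differentials\<close>

text \<open>The function field is \<open>K(x)\<close>, the fraction field of the polynomial ring. The value of
  the orders of vanishing at the zero function is a dummy.\<close>

lift_definition ord_finite :: "'a::field \<Rightarrow> 'a poly fract \<Rightarrow> int" is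
  "\<lambda>a (p, q). if p = 0 then 0 else int (Polynomial.order a p) - int (Polynomial.order a q)"
proof -
  fix a :: 'a and x y :: "'a poly \<times> 'a poly"
  assume "fractrel x y"
  then obtain p q r s where xy: "x = (p, q)" "y = (r, s)"
    and nz: "q \<noteq> 0" "s \<noteq> 0" and eq: "p * s = r * q"
    by (cases x; cases y) (auto simp: fractrel_def)
  show "(case x of (p, q) \<Rightarrow> if p = 0 then 0 else int (Polynomial.order a p) - int (Polynomial.order a q)) =
        (case y of (p, q) \<Rightarrow> if p = 0 then 0 else int (Polynomial.order a p) - int (Polynomial.order a q))"
  proof (cases "p = 0")
    case True
    with eq nz have "r = 0" by simp
    with True xy show ?thesis by simp
  next
    case False
    with eq nz have "r \<noteq> 0" by auto
    have "Polynomial.order a (p * s) = Polynomial.order a (r * q)" by (simp only: eq)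
    with False \<open>r \<noteq> 0\<close> nz show ?thesis by (simp add: order_mult xy)
  qed
qed

lift_definition ord_infinity :: "'a::field poly fract \<Rightarrow> int" is
  "\<lambda>(p, q). if p = 0 then 0 else int (degree q) - int (degree p)"
proof -
  fix x y :: "'a poly \<times> 'a poly"
  assume "fractrel x y"
  then obtain p q r s where xy: "x = (p, q)" "y = (r, s)"
    and nz: "q \<noteq> 0" "s \<noteq> 0" and eq: "p * s = r * q"
    by (cases x; cases y) (auto simp: fractrel_def)
  show "(case x of (p, q) \<Rightarrow> if p = 0 then 0 else int (degree q) - int (degree p)) =
        (case y of (p, q) \<Rightarrow> if p = 0 then 0 else int (degree q) - int (degree p))"
  proof (cases "p = 0")
    case True
    with eq nz have "r = 0" by simp
    with True xy show ?thesis by simp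
  next
    case False
    with eq nz have "r \<noteq> 0" by auto
    have "degree (p * s) = degree (r * q)" by (simp only: eq)
    with False \<open>r \<noteq> 0\<close> nz show ?thesis by (simp add: degree_mult_eq xy)
  qed
qed

lift_definition fract_deriv :: "'a::field poly fract \<Rightarrow> 'a poly fract" is
  "\<lambda>(p, q). (pderiv p * q - p * pderiv q, q * q)"
proof -
  fix x y :: "'a poly \<times> 'a poly"
  assume "fractrel x y"
  then obtain p q r s where xy: "x = (p, q)" "y = (r, s)"
    and nz: "q \<noteq> 0" "s \<noteq> 0" and eq: "p * s = r * q"
    by (cases x; cases y) (auto simp: fractrel_def)
  have d: "pderiv p * s + p * pderiv s = pderiv r * q + r * pderiv q"
    using arg_cong[OF eq, of pderiv] by (simp add: pderiv_mult algebra_simps)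
  have "(pderiv p * q - p * pderiv q) * (s * s) = (pderiv r * s - r * pderiv s) * (q * q)"
    using d eq by algebra
  with nz show "fractrel (case x of (p, q) \<Rightarrow> (pderiv p * q - p * pderiv q, q * q))
                         (case y of (p, q) \<Rightarrow> (pderiv p * q - p * pderiv q, q * q))"
    by (simp add: xy fractrel_def)
qed

definition ord_at :: "'a::field proj_line \<Rightarrow> 'a poly fract \<Rightarrow> int" where
  "ord_at p f = (if p = pt_inf then ord_infinity f else ord_finite (affine_coord p) f)"

definition local_param :: "'a::field proj_line \<Rightarrow> 'a poly fract" where
  "local_param p = (if p = pt_inf then Fract 1 [:0, 1:] else Fract [:- affine_coord p, 1:] 1)"

text \<open>Order of the rational differential \<open>g dx\<close> at \<open>p\<close>: if \<open>t\<close> is a local parameter then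
  \<open>g dx = (g / t') dt\<close>, with \<open>t'\<close> the derivative with respect to \<open>x\<close>.\<close>

definition ord_diff :: "'a::field proj_line \<Rightarrow> 'a poly fract \<Rightarrow> int" where
  "ord_diff p g = ord_at p (g / fract_deriv (local_param p))"


section \<open>Divisors\<close>

text \<open>The prime divisors of a curve are its points.\<close>

definition is_divisor :: "('a::field proj_line \<Rightarrow> 'b::zero) \<Rightarrow> bool" where
  "is_divisor D \<longleftrightarrow> finite {p. D p \<noteq> 0}"

definition lin_equiv :: "('a::field proj_line \<Rightarrow> int) \<Rightarrow> ('a proj_line \<Rightarrow> int) \<Rightarrow> bool" where
  "lin_equiv D E \<longleftrightarrow> (\<exists>f. f \<noteq> 0 \<and> (\<forall>p. D p - E p = ord_at p f))"

definition complete_linear_system :: "('a::field proj_line \<Rightarrow> int) \<Rightarrow> ('a proj_line \<Rightarrow> int) set" where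
  "complete_linear_system D = {E. is_divisor E \<and> (\<forall>p. E p \<ge> 0) \<and> lin_equiv E D}"

text \<open>The divisor of \<open>dx\<close>.\<close>

definition K_P1 :: "'a::field proj_line \<Rightarrow> int" where
  "K_P1 p = ord_diff p 1"

definition cartier :: "('a::field proj_line \<Rightarrow> int) \<Rightarrow> bool" where
  "cartier M \<longleftrightarrow> (\<forall>p. \<exists>U f. zariski_closed (- U) \<and> p \<in> U \<and> f \<noteq> 0 \<and> (\<forall>q\<in>U. M q = ord_at q f))"

definition Q_cartier :: "('a::field proj_line \<Rightarrow> rat) \<Rightarrow> bool" where
  "Q_cartier E \<longleftrightarrow> (\<exists>m::nat. m \<ge> 1 \<and>
     (\<exists>M. cartier M \<and> (\<forall>p. of_nat m * E p = of_int (M p))))"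


section \<open>Pairs, dual complexes and coregularity\<close>

definition log_pair :: "('a::field proj_line \<Rightarrow> rat) \<Rightarrow> bool" where
  "log_pair D \<longleftrightarrow> is_divisor D \<and> (\<forall>p. 0 \<le> D p \<and> D p \<le> 1) \<and> Q_cartier (\<lambda>p. of_int (K_P1 p) + D p)"

definition invariant_divisor :: "('a::field ^ 2 ^ 2) set set \<Rightarrow> ('a proj_line \<Rightarrow> rat) \<Rightarrow> bool" where
  "invariant_divisor G D \<longleftrightarrow> (\<forall>g\<in>G. \<forall>p. D (pgl_act g p) = D p)"

text \<open>On a smooth curve the support of any divisor is simple normal crossing, so the identity
  is a log resolution \<open>f : Y \<rightarrow> X\<close>; the equation \<open>K_Y + D_Y = f\<^sup>*(K_X + D)\<close> then gives \<open>D_Y\<close>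
  on \<open>Y = X\<close>.\<close>

definition log_resolution_divisor :: "('a::field proj_line \<Rightarrow> rat) \<Rightarrow> 'a proj_line \<Rightarrow> rat" where
  "log_resolution_divisor D p = (of_int (K_P1 p) + D p) - of_int (K_P1 p)"

definition lc :: "('a::field proj_line \<Rightarrow> rat) \<Rightarrow> bool" where
  "lc D \<longleftrightarrow> (\<forall>p. log_resolution_divisor D p \<le> 1)"

definition coeff_one_components :: "('a::field proj_line \<Rightarrow> rat) \<Rightarrow> 'a proj_line set set" where
  "coeff_one_components D = {{p} | p. log_resolution_divisor D p = 1}"

text \<open>The \<open>(k - 1)\<close>-dimensional cells, indexed by \<open>k\<close> distinct components and an irreducible
  component of their intersection.\<close>

definition dual_cells ::
  "('a::field proj_line \<Rightarrow> rat) \<Rightarrow> nat \<Rightarrow> ('a proj_line set set \<times> 'a proj_line set) set" where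
  "dual_cells D k = {(C, Z). C \<subseteq> coeff_one_components D \<and> finite C \<and> card C = k \<and>
     irreducible_component_of (\<Inter>C) Z}"

definition dim_dual_complex :: "('a::field proj_line \<Rightarrow> rat) \<Rightarrow> int" where
  "dim_dual_complex D =
     (let N = {k. k \<ge> 1 \<and> dual_cells D k \<noteq> {}} in if N = {} then -1 else int (Max N) - 1)"

definition anticanonical_Q_system :: "nat \<Rightarrow> ('a::field proj_line \<Rightarrow> rat) set" where
  "anticanonical_Q_system l = {D. \<exists>M \<in> complete_linear_system (\<lambda>p. - int l * K_P1 p).
     \<forall>p. D p = of_int (M p) / of_nat l}"

text \<open>The maxima are taken in the extended reals, so that the maximum over an empty family
  of pairs is \<open>-\<infinity>\<close>. Nonempty families have integer values bounded by \<open>dim X - 1\<close>,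
  so they attain their suprema.\<close>

definition reg_l :: "('a::field ^ 2 ^ 2) set set \<Rightarrow> nat \<Rightarrow> ereal" where
  "reg_l G l = (SUP D \<in> {D. log_pair D \<and> lc D \<and> invariant_divisor G D \<and> D \<in> anticanonical_Q_system l}.
     ereal (real_of_int (dim_dual_complex D)))"

definition reg :: "('a::field ^ 2 ^ 2) set set \<Rightarrow> ereal" where
  "reg G = (SUP l \<in> {1..}. reg_l G l)"

definition dim_P1 :: ereal where
  "dim_P1 = 1"

definition coreg :: "('a::field ^ 2 ^ 2) set set \<Rightarrow> ereal" where
  "coreg G = dim_P1 - 1 - reg G"

end

theory Submission
  imports Defs "HOL-Algebra.Multiplicative_Group"
begin

text \<open>
  An anticanonical \<open>\<rat>\<close>-divisor on the projective line has degree \<open>2\<close>, and components of such a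
  divisor never meet. So the dual complex of a pair is a finite set of points, of dimension
  \<open>0\<close> if some coefficient of \<open>D\<close> is \<open>1\<close>, and empty otherwise
  (\<open>dim_dual_complex_eq\<close>). Spreading degree \<open>2\<close> evenly over a finite invariant set of at least two
  points always gives an invariant pair (\<open>invariant_set_log_CY_pair\<close>), so the coregularity is
  \<open>0\<close> or \<open>1\<close>, and it is \<open>0\<close> exactly when some invariant \<open>D\<close> has a coefficient \<open>1\<close>.

  Such a coefficient is shared by the whole orbit of its point, and the degree leaves room for
  at most two points (\<open>card_coeff_one_le\<close>). Conversely, on an invariant pair of points the evenly
  spread divisor has coefficients \<open>1\<close>. The question thus becomes which finite groups have a
  fixed point or an invariant pair of points.

  A finite group fixing a point acts by matrices that are upper triangular in a suitable basis.
  The ratio of the diagonal entries is a character with values in the field; its kernel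
  consists of unipotent elements of finite order, which are trivial in characteristic \<open>0\<close>. Hence
  the group is a finite group of roots of unity, and cyclic (\<open>cyclic_if_fixes_point\<close>). If the
  group preserves a pair of points and swaps them, then the stabiliser of either is cyclic of
  index \<open>2\<close> and every element outside it is an involution, so the group is dihedral
  (\<open>cyclic_or_dihedral_if_invariant_pair\<close>). In the other direction, a nontrivial element of finite
  order is diagonalisable and has exactly two fixed points
  (\<open>finite_order_two_fixed_points\<close>). Nontrivial cyclic and dihedral groups contain a nontrivial
  element that is conjugate only to itself and its inverse, and its two fixed points
  form an invariant pair (\<open>invariant_pair_if_cyclic_or_dihedral\<close>).
\<close>

section \<open>Finite groups with a faithful character, and dihedral groups\<close>

text \<open>A nonzero polynomial over a field has at most as many roots as its degree, so
  \<open>x ^ d = 1\<close> has at most \<open>d\<close> solutions in the group. One element \<open>a\<close> of order \<open>d\<close> already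
  supplies \<open>d\<close> of them, its powers; every element of order \<open>d\<close> is therefore a power of \<open>a\<close>
  with exponent prime to \<open>d\<close>.\<close>

lemma (in group) card_order_le_phi:
  fixes \<phi> :: "'a \<Rightarrow> 'k :: field"
  assumes fin: "finite (carrier G)"
    and hom: "\<And>x y. x \<in> carrier G \<Longrightarrow> y \<in> carrier G \<Longrightarrow> \<phi> (x \<otimes> y) = \<phi> x * \<phi> y"
    and one: "\<phi> \<one> = 1" and inj: "inj_on \<phi> (carrier G)" and d: "d > 0"
  shows "card {x \<in> carrier G. ord x = d} \<le> phi' d"
proof (cases "\<exists>a\<in>carrier G. ord a = d")
  case False
  then have none: "{x \<in> carrier G. ord x = d} = {}" by auto
  show ?thesis unfolding none by simp
next
  case True
  then obtain a where a: "a \<in> carrier G" "ord a = d" by auto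
  have pow: "\<phi> (x [^] n) = \<phi> x ^ n" if "x \<in> carrier G" for x and n :: nat
    using that by (induction n) (simp_all add: one hom)
  let ?T = "{x \<in> carrier G. x [^] d = \<one>}"
  let ?q = "Polynomial.monom 1 d - 1 :: 'k poly"
  have q: "?q \<noteq> 0"
    using d by (metis degree_1 degree_monom_eq eq_iff_diff_eq_0 less_irrefl zero_neq_one)
  have deg: "degree ?q \<le> d"
    by (rule degree_diff_le) (simp_all add: degree_monom_le)
  have "card ?T = card (\<phi> ` ?T)"
    by (rule card_image[symmetric]) (rule inj_on_subset[OF inj], auto)
  also have "\<dots> \<le> card {z. poly ?q z = 0}"
    by (rule card_mono[OF poly_roots_finite[OF q]]) (auto simp: poly_monom pow[symmetric] one)
  also have "\<dots> \<le> d"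
    using card_poly_roots_bound[OF q] deg by linarith
  finally have cT: "card ?T \<le> d" .
  have inja: "inj_on (\<lambda>n. a [^] n) {1..d}" using ord_inj'[OF a(1)] a(2) by simp
  have sub: "(\<lambda>n. a [^] n) ` {1..d} \<subseteq> ?T"
  proof (safe)
    fix n :: nat
    have "(a [^] n) [^] d = (a [^] d) [^] n" using a(1) by (simp add: nat_pow_pow mult.commute)
    then show "(a [^] n) [^] d = \<one>" using a pow_ord_eq_1[OF a(1)] by simp
  qed (use a in auto)
  have T: "(\<lambda>n. a [^] n) ` {1..d} = ?T"
    by (rule card_seteq[OF _ sub]) (use fin cT card_image[OF inja] in auto)
  have "{x \<in> carrier G. ord x = d} \<subseteq> (\<lambda>n. a [^] n) ` {n. 1 \<le> n \<and> n \<le> d \<and> coprime n d}"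
  proof
    fix x assume x: "x \<in> {x \<in> carrier G. ord x = d}"
    then have "x \<in> ?T" using pow_ord_eq_1[of x] by auto
    then obtain n where n: "n \<in> {1..d}" "x = a [^] n" using T by blast
    then have "coprime n d" using pow_ord_eq_ord_iff[OF fin a(1), of n] a(2) x by simp
    then show "x \<in> (\<lambda>n. a [^] n) ` {n. 1 \<le> n \<and> n \<le> d \<and> coprime n d}" using n by auto
  qed
  then have "card {x \<in> carrier G. ord x = d} \<le> card ((\<lambda>n. a [^] n) ` {n. 1 \<le> n \<and> n \<le> d \<and> coprime n d})"
    by (intro card_mono) auto
  also have "\<dots> \<le> phi' d" unfolding phi'_def by (rule card_image_le) auto
  finally show ?thesis .
qed

text \<open>The elements of a group of order \<open>N\<close> are distributed over the divisors \<open>d\<close> of \<open>N\<close>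
  according to their orders, with at most \<open>phi' d\<close> elements for each. The totients of the divisors
  sum to \<open>N\<close>, so none of these bounds is strict; for \<open>d = N\<close> this gives a generator.\<close>

lemma (in group) cyclic_if_injects_into_field:
  fixes \<phi> :: "'a \<Rightarrow> 'k :: field"
  assumes fin: "finite (carrier G)"
    and hom: "\<And>x y. x \<in> carrier G \<Longrightarrow> y \<in> carrier G \<Longrightarrow> \<phi> (x \<otimes> y) = \<phi> x * \<phi> y"
    and one: "\<phi> \<one> = 1" and inj: "inj_on \<phi> (carrier G)"
  shows "cyclic_group G"
proof -
  let ?N = "order G" and ?E = "\<lambda>d. {x \<in> carrier G. ord x = d}"
  have N: "?N > 0" using fin by (simp add: order_gt_0_iff_finite)
  have finD: "finite {d. d dvd ?N}" using N by simp
  have "(\<Sum>d | d dvd ?N. card (?E d)) = card (\<Union>d\<in>{d. d dvd ?N}. ?E d)"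
    by (rule card_UN_disjoint[symmetric]) (use fin finD in auto)
  also have "(\<Union>d\<in>{d. d dvd ?N}. ?E d) = carrier G"
    using ord_dvd_group_order by auto
  finally have S: "(\<Sum>d | d dvd ?N. card (?E d)) = (\<Sum>d | d dvd ?N. phi' d)"
    using sum_phi'_factors[OF N] by (simp add: order_def)
  have le: "card (?E d) \<le> phi' d" if "d dvd ?N" for d
    using card_order_le_phi[OF fin hom one inj, of d] dvd_pos_nat[OF N that] by blast
  have "card (?E ?N) = phi' ?N"
  proof (rule ccontr)
    assume "card (?E ?N) \<noteq> phi' ?N"
    then have "card (?E ?N) < phi' ?N" using le[of ?N] by simp
    then have "(\<Sum>d | d dvd ?N. card (?E d)) < (\<Sum>d | d dvd ?N. phi' d)"
      by (intro sum_strict_mono_ex1[OF finD]) (use le \<open>card (?E ?N) < phi' ?N\<close> dvd_refl in blast)+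
    then show False using S by simp
  qed
  then have "?E ?N \<noteq> {}" using phi'_nonzero[OF N] by force
  then obtain a where a: "a \<in> carrier G" "ord a = ?N" by auto
  have "generate G {a} \<subseteq> carrier G" using a by (simp add: generate_incl)
  moreover have "card (generate G {a}) = card (carrier G)"
    using generate_pow_card[OF a(1)] a(2) by (simp add: order_def)
  ultimately have "generate G {a} = carrier G" using fin by (simp add: card_subset_eq)
  then show ?thesis
    unfolding cyclic_group using a(1) generate_pow[OF a(1)] by (auto simp: full_SetCompr_eq)
qed

text \<open>That \<open>s\<close> and \<open>r [^] i \<otimes> s\<close> are both involutions forces
  \<open>s \<otimes> r [^] i = r [^] (- i) \<otimes> s\<close>, which is the multiplication rule of the dihedral group.\<close>

lemma (in group) dihedral_if_involutions_off_cyclic: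
  assumes fin: "finite (carrier G)" and r: "r \<in> carrier G" and s: "s \<in> carrier G"
    and off: "s \<notin> range (\<lambda>i::int. r [^] i)"
    and cov: "carrier G \<subseteq> range (\<lambda>i::int. r [^] i) \<union> range (\<lambda>i::int. r [^] i \<otimes> s)"
    and invol: "\<And>i::int. (r [^] i \<otimes> s) \<otimes> (r [^] i \<otimes> s) = \<one>"
  shows "is_dihedral G"
proof -
  define n where "n = ord r"
  have n: "n \<ge> 1" unfolding n_def using ord_ge_1[OF fin r] .
  have modn: "r [^] (i mod int n) = r [^] i" for i :: int
    using int_pow_eq[OF r] by (simp add: n_def mod_eq_dvd_iff[symmetric])
  have ss: "s \<otimes> s = \<one>" using invol[of 0] s by simp
  have swap: "s \<otimes> r [^] i = r [^] (- i) \<otimes> s" for i :: int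
  proof -
    have c: "r [^] i \<in> carrier G" using r by simp
    have "r [^] i \<otimes> (s \<otimes> r [^] i \<otimes> s) = \<one>" using invol[of i] c s by (simp add: m_assoc)
    then have "s \<otimes> r [^] i \<otimes> s = inv (r [^] i)"
      using c s by (metis inv_equality inv_inv m_closed)
    then have "s \<otimes> r [^] i \<otimes> s \<otimes> s = r [^] (- i) \<otimes> s" using r by (simp add: int_pow_neg)
    then show ?thesis using c s ss by (simp add: m_assoc)
  qed
  define h where "h = (\<lambda>(i::int, e). if e then r [^] i \<otimes> s else r [^] i)"
  have add: "r [^] i \<otimes> r [^] j = r [^] (i + j)" for i j :: int using r by (simp add: int_pow_mult)
  have add': "r [^] i \<otimes> (r [^] j \<otimes> s) = r [^] (i + j) \<otimes> s" for i j :: int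
    using r s by (simp add: int_pow_mult m_assoc)
  have sw': "r [^] i \<otimes> s \<otimes> r [^] j = r [^] (i - j) \<otimes> s" for i j :: int
  proof -
    have "r [^] i \<otimes> s \<otimes> r [^] j = r [^] i \<otimes> (s \<otimes> r [^] j)" using r s by (simp add: m_assoc)
    also have "\<dots> = r [^] (i - j) \<otimes> s" by (simp add: swap add')
    finally show ?thesis .
  qed
  have sw'': "r [^] i \<otimes> s \<otimes> (r [^] j \<otimes> s) = r [^] (i - j)" for i j :: int
  proof -
    have "r [^] i \<otimes> s \<otimes> (r [^] j \<otimes> s) = r [^] i \<otimes> s \<otimes> r [^] j \<otimes> s" using r s by (simp add: m_assoc)
    also have "\<dots> = r [^] (i - j) \<otimes> (s \<otimes> s)" using r s by (simp add: sw' m_assoc)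
    finally show ?thesis using r by (simp add: ss)
  qed
  have hom: "h \<in> hom (dihedral_group n) G"
    by (rule homI) (auto simp: h_def dihedral_group_def modn add add' sw' sw'' r s)
  have inj0: "i = j" if "r [^] i = r [^] j" "0 \<le> i" "i < int n" "0 \<le> j" "j < int n" for i j :: int
  proof -
    have "i mod int n = j mod int n"
      using that(1) int_pow_eq[OF r] by (metis mod_eq_dvd_iff n_def)
    then show ?thesis using that by simp
  qed
  have disj: "r [^] i \<noteq> r [^] j \<otimes> s" for i j :: int
  proof
    assume "r [^] i = r [^] j \<otimes> s"
    then have "r [^] (- j) \<otimes> r [^] i = r [^] (- j) \<otimes> (r [^] j \<otimes> s)" by simp
    then have "r [^] (i - j) = s" by (simp add: add add' s)
    then show False using off by auto
  qed
  have inj: "inj_on h (carrier (dihedral_group n))"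
  proof (rule inj_onI, clarify)
    fix i e j f
    assume 1: "(i, e) \<in> carrier (dihedral_group n)" "(j, f) \<in> carrier (dihedral_group n)"
      and 2: "h (i, e) = h (j, f)"
    have "r [^] i = r [^] j \<and> e = f"
      using 2 disj disj[symmetric] r s by (auto simp: h_def split: if_splits)
    then show "i = j \<and> e = f" using inj0 1 by (auto simp: dihedral_group_def)
  qed
  have surj: "h ` carrier (dihedral_group n) = carrier G"
  proof
    show "h ` carrier (dihedral_group n) \<subseteq> carrier G" using r s by (auto simp: h_def)
    show "carrier G \<subseteq> h ` carrier (dihedral_group n)"
    proof
      fix x assume "x \<in> carrier G"
      then consider i :: int where "x = r [^] i" | i :: int where "x = r [^] i \<otimes> s" using cov by blast
      then show "x \<in> h ` carrier (dihedral_group n)"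
      proof cases
        case 1
        then have "x = h (i mod int n, False)" by (simp add: h_def modn)
        then show ?thesis using n by (auto simp: dihedral_group_def)
      next
        case 2
        then have "x = h (i mod int n, True)" by (simp add: h_def modn)
        then show ?thesis using n by (auto simp: dihedral_group_def)
      qed
    qed
  qed
  have "dihedral_group n \<cong> G"
    by (rule is_isoI) (use hom inj surj in \<open>simp add: iso_iff\<close>)
  then have "G \<cong> dihedral_group n" by (rule group.iso_sym[OF group_dihedral_group[OF n]])
  then show ?thesis unfolding is_dihedral_def using n by blast
qed

section \<open>Homogeneous coordinates and the action on points\<close>

definition proj_pt :: "'a::field ^ 2 \<Rightarrow> 'a proj_line" where
  "proj_pt v = proj_line_of (vec.span {v})"

text \<open>The determinant of the matrix with columns \<open>v\<close> and \<open>w\<close>; its vanishing detects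
  equality of points without choosing an affine chart.\<close>

definition cross2 :: "'a::field ^ 2 \<Rightarrow> 'a ^ 2 \<Rightarrow> 'a" where
  "cross2 v w = v $ 1 * w $ 2 - v $ 2 * w $ 1"

text \<open>The class in \<open>PGL2\<close> of an invertible matrix, as its explicit set of multiples.\<close>

definition proj_class :: "'a::field ^ 2 ^ 2 \<Rightarrow> ('a ^ 2 ^ 2) set" where
  "proj_class A = {mat c ** A | c. c \<noteq> 0}"

lemma line_of_proj_pt: "v \<noteq> 0 \<Longrightarrow> line_of (proj_pt v) = vec.span {v}"
  unfolding proj_pt_def by (rule proj_line_of_inverse) auto

lemma proj_pt_cases:
  obtains v where "v \<noteq> 0" "p = proj_pt v"
proof -
  obtain v where "v \<noteq> 0" "line_of p = vec.span {v}" using line_of[of p] by auto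
  then have "p = proj_pt v" by (metis line_of_inverse proj_pt_def)
  with \<open>v \<noteq> 0\<close> show thesis by (rule that)
qed

lemma cross2_simps [simp]:
  "cross2 v v = 0"
  "cross2 0 v = 0" "cross2 v 0 = 0"
  "cross2 (c *s v) w = c * cross2 v w"
  "cross2 v (c *s w) = c * cross2 v w"
  "cross2 (u + v) w = cross2 u w + cross2 v w"
  "cross2 v (u + w) = cross2 v u + cross2 v w"
  by (simp_all add: cross2_def algebra_simps)

lemma cross2_commute: "cross2 w v = - cross2 v w"
  by (simp add: cross2_def)

text \<open>Cramer's rule for the basis \<open>v, w\<close>.\<close>

lemma cross2_expand:
  assumes "cross2 v w \<noteq> 0"
  shows "u = (cross2 u w / cross2 v w) *s v + (cross2 v u / cross2 v w) *s w"
  using assms by (simp add: vec_eq_iff forall_2 divide_simps) (simp add: cross2_def algebra_simps)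

lemma cross2_eq_0_iff:
  assumes "v \<noteq> 0"
  shows "cross2 v w = 0 \<longleftrightarrow> (\<exists>c. w = c *s v)"
proof
  assume c: "cross2 v w = 0"
  show "\<exists>c. w = c *s v"
  proof (cases "v $ 1 = 0")
    case True
    then have "v $ 2 \<noteq> 0" using assms by (simp add: vec_eq_iff forall_2)
    then show ?thesis using c True
      by (intro exI[of _ "w $ 2 / v $ 2"]) (simp add: vec_eq_iff forall_2 cross2_def)
  next
    case False
    then show ?thesis using c
      by (intro exI[of _ "w $ 1 / v $ 1"]) (simp add: vec_eq_iff forall_2 cross2_def field_simps)
  qed
qed auto

lemma proj_pt_eq_iff:
  assumes "v \<noteq> 0" "w \<noteq> 0"
  shows "proj_pt v = proj_pt w \<longleftrightarrow> cross2 v w = 0"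
proof
  assume "proj_pt v = proj_pt w"
  then have "vec.span {v} = vec.span {w}" using line_of_proj_pt assms by metis
  then have "w \<in> vec.span {v}" using vec.span_base[of w "{w}"] by simp
  then show "cross2 v w = 0" by (auto simp: vec.span_singleton)
next
  assume "cross2 v w = 0"
  then obtain c where c: "w = c *s v" using cross2_eq_0_iff[OF assms(1)] by auto
  then have "c \<noteq> 0" using assms by auto
  have "vec.span {v} = vec.span {w}"
  proof (rule Set.set_eqI)
    fix x
    have "k *s v = (k / c) *s w" "k *s w = (k * c) *s v" for k using \<open>c \<noteq> 0\<close> c by simp_all
    then have "(\<exists>k. x = k *s v) \<longleftrightarrow> (\<exists>k. x = k *s w)" by blast
    then show "x \<in> vec.span {v} \<longleftrightarrow> x \<in> vec.span {w}"
      by (auto simp: vec.span_singleton)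
  qed
  then show "proj_pt v = proj_pt w" by (simp add: proj_pt_def)
qed

lemma mat_mult_vec: "(mat c ** A) *v v = c *s (A *v v)" for A :: "'a::field ^ 2 ^ 2"
  by (simp add: matrix_vector_mult_def matrix_matrix_mult_def mat_def vec_eq_iff forall_2 sum_2 algebra_simps)

lemma mat_vec: "mat c *v v = c *s v" for v :: "'a::field ^ 2"
  by (simp add: matrix_vector_mult_def mat_def vec_eq_iff forall_2 sum_2)

lemma invertible_mult_vec_neq_0:
  assumes "invertible A" "v \<noteq> 0"
  shows "A *v v \<noteq> (0 :: 'a::field ^ 2)"
proof
  assume "A *v v = 0"
  obtain B where "B ** A = mat 1" using assms by (auto simp: invertible_def)
  then have "v = B *v (A *v v)" by (simp add: matrix_vector_mul_assoc)
  then show False using \<open>A *v v = 0\<close> assms by simp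
qed

lemma pgl_act_proj_class:
  assumes "invertible A" "v \<noteq> 0"
  shows "pgl_act (proj_class A) (proj_pt v) = proj_pt (A *v v)"
proof -
  have "(\<Union>B\<in>proj_class A. (\<lambda>v. B *v v) ` line_of (proj_pt v)) = vec.span {A *v v}"
  proof (rule Set.set_eqI)
    fix x
    have act: "(mat c ** A) *v (k *s v) = (c * k) *s (A *v v)" for c k
      by (simp add: mat_mult_vec vec.scale)
    show "x \<in> (\<Union>B\<in>proj_class A. (\<lambda>v. B *v v) ` line_of (proj_pt v)) \<longleftrightarrow> x \<in> vec.span {A *v v}"
    proof
      assume "x \<in> (\<Union>B\<in>proj_class A. (\<lambda>v. B *v v) ` line_of (proj_pt v))"
      then show "x \<in> vec.span {A *v v}"
        by (auto simp: proj_class_def line_of_proj_pt[OF assms(2)] vec.span_singleton act)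
    next
      assume "x \<in> vec.span {A *v v}"
      then obtain k where "x = (1 * k) *s (A *v v)" by (auto simp: vec.span_singleton)
      then have "x = (mat 1 ** A) *v (k *s v)" unfolding act .
      moreover have "mat 1 ** A \<in> proj_class A"
        unfolding proj_class_def using zero_neq_one[symmetric] by (intro CollectI exI[of _ 1] conjI refl)
      moreover have "k *s v \<in> line_of (proj_pt v)"
        unfolding line_of_proj_pt[OF assms(2)] vec.span_singleton by (rule rangeI)
      ultimately show "x \<in> (\<Union>B\<in>proj_class A. (\<lambda>v. B *v v) ` line_of (proj_pt v))" by blast
    qed
  qed
  then show ?thesis unfolding pgl_act_def proj_pt_def[of "A *v v"] by simp
qed

lemma proj_class_eq_r_coset: "proj_class A = scalars2 #>\<^bsub>GL2\<^esub> A"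
  by (auto simp: proj_class_def r_coset_def scalars2_def GL2_def)

lemma carrier_PGL2: "carrier PGL2 = proj_class ` {A :: 'a::field ^ 2 ^ 2. invertible A}"
  by (auto simp: PGL2_def FactGroup_def RCOSETS_def proj_class_eq_r_coset GL2_def)

lemma one_PGL2: "\<one>\<^bsub>PGL2\<^esub> = proj_class (mat 1 :: 'a::field ^ 2 ^ 2)"
  by (simp add: PGL2_def FactGroup_def proj_class_def scalars2_def)

lemma proj_class_hom: "proj_class \<in> hom GL2 (PGL2 :: ('a::field ^ 2 ^ 2) set monoid)"
  using normal.r_coset_hom_Mod[OF normal_scalars2]
  by (simp add: PGL2_def proj_class_eq_r_coset[abs_def])

lemma mult_PGL2:
  assumes "invertible A" "invertible (B :: 'a::field ^ 2 ^ 2)"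
  shows "proj_class A \<otimes>\<^bsub>PGL2\<^esub> proj_class B = proj_class (A ** B)"
  using hom_mult[OF proj_class_hom, of A B] assms by (simp add: GL2_def)

lemma proj_class_eq_one_iff:
  "proj_class A = \<one>\<^bsub>PGL2\<^esub> \<longleftrightarrow> (\<exists>c. c \<noteq> 0 \<and> A = mat c)" for A :: "'a::field ^ 2 ^ 2"
proof
  assume "proj_class A = \<one>\<^bsub>PGL2\<^esub>"
  moreover have "A \<in> proj_class A" by (auto simp: proj_class_def intro!: exI[of _ 1])
  ultimately show "\<exists>c. c \<noteq> 0 \<and> A = mat c" by (auto simp: one_PGL2 proj_class_def)
next
  assume "\<exists>c. c \<noteq> 0 \<and> A = mat c"
  then obtain c where c: "c \<noteq> 0" "A = mat c" by auto
  have "mat d ** mat c = (mat (d * c) :: 'a ^ 2 ^ 2)" for d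
    by (simp add: matrix_matrix_mult_def mat_def vec_eq_iff forall_2 sum_2)
  then show "proj_class A = \<one>\<^bsub>PGL2\<^esub>"
    using c by (auto simp: one_PGL2 proj_class_def) (metis divide_eq_0_iff nonzero_eq_divide_eq)
qed

lemma pgl_act_one: "pgl_act \<one>\<^bsub>PGL2\<^esub> p = p"
proof -
  obtain v where "v \<noteq> 0" "p = proj_pt v" by (rule proj_pt_cases)
  then show ?thesis by (simp add: one_PGL2 pgl_act_proj_class invertible_def[of "mat 1"])
qed

lemma pgl_act_mult:
  assumes "g \<in> carrier PGL2" "h \<in> carrier PGL2"
  shows "pgl_act (g \<otimes>\<^bsub>PGL2\<^esub> h) p = pgl_act g (pgl_act h p)"
proof -
  obtain A B where AB: "invertible A" "g = proj_class A" "invertible B" "h = proj_class B"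
    using assms by (auto simp: carrier_PGL2)
  obtain v where "v \<noteq> 0" "p = proj_pt v" by (rule proj_pt_cases)
  then show ?thesis using AB
    by (simp add: mult_PGL2 pgl_act_proj_class invertible_mult invertible_mult_vec_neq_0
          matrix_vector_mul_assoc)
qed

lemma pgl_act_inv:
  assumes "g \<in> carrier PGL2"
  shows "pgl_act (inv\<^bsub>PGL2\<^esub> g) (pgl_act g p) = p"
proof -
  interpret group PGL2 by (rule group_PGL2)
  show ?thesis using assms by (simp add: pgl_act_mult[symmetric] pgl_act_one)
qed

lemma matrix_eq_if_on_basis:
  fixes A B :: "'a::field ^ 2 ^ 2"
  assumes "cross2 v w \<noteq> 0" "A *v v = B *v v" "A *v w = B *v w"
  shows "A = B"
proof -
  have "A *v u = B *v u" for u
    by (subst (1 2) cross2_expand[OF assms(1)])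
       (simp add: matrix_vector_right_distrib vec.scale assms)
  then show ?thesis by (simp add: matrix_eq)
qed

section \<open>Elements of finite order and point stabilisers\<close>

lemma pgl_act_fixes_iff:
  assumes "invertible A" "v \<noteq> 0"
  shows "pgl_act (proj_class A) (proj_pt v) = proj_pt v \<longleftrightarrow> (\<exists>a. a \<noteq> 0 \<and> A *v v = a *s v)"
proof -
  have nz: "A *v v \<noteq> 0" by (rule invertible_mult_vec_neq_0[OF assms])
  have "pgl_act (proj_class A) (proj_pt v) = proj_pt v \<longleftrightarrow> cross2 v (A *v v) = 0"
    unfolding pgl_act_proj_class[OF assms]
    using proj_pt_eq_iff[OF assms(2) nz] by metis
  also have "\<dots> \<longleftrightarrow> (\<exists>a. A *v v = a *s v)" by (rule cross2_eq_0_iff[OF assms(2)])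
  also have "\<dots> \<longleftrightarrow> (\<exists>a. a \<noteq> 0 \<and> A *v v = a *s v)" using nz by force
  finally show ?thesis .
qed

lemma exists_cross2_neq_0:
  assumes "v \<noteq> 0"
  obtains w :: "'a::field ^ 2" where "cross2 v w \<noteq> 0"
proof (cases "v $ 1 = 0")
  case True
  then have "cross2 v (axis 1 1) \<noteq> 0" using assms by (simp add: cross2_def axis_def vec_eq_iff forall_2)
  then show ?thesis by (rule that)
next
  case False
  then have "cross2 v (axis 2 1) \<noteq> 0" by (simp add: cross2_def axis_def)
  then show ?thesis by (rule that)
qed

text \<open>In characteristic \<open>0\<close> a nontrivial unipotent matrix has infinite order: the off-diagonal
  entry \<open>c\<close> of the \<open>n\<close>-th power of an upper triangular matrix with both eigenvalues \<open>a\<close> is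
  \<open>n a ^ (n - 1) b\<close>. The last conjunct is multiplied by \<open>a\<close> to avoid the exponent \<open>n - 1\<close>
  at \<open>n = 0\<close>.\<close>

lemma unipotent_part_of_power:
  fixes A :: "'a::field ^ 2 ^ 2"
  assumes "invertible A" "A *v v = a *s v" "A *v w = a *s w + b *s v"
  shows "\<exists>B c. invertible B \<and> proj_class A [^]\<^bsub>PGL2\<^esub> n = proj_class B \<and> B *v v = a ^ n *s v
    \<and> B *v w = a ^ n *s w + c *s v \<and> a * c = of_nat n * a ^ n * b"
proof (induction n)
  case 0
  have "invertible (mat 1 :: 'a ^ 2 ^ 2)" by (simp add: invertible_def[of "mat 1"])
  then show ?case
    by (intro exI[of _ "mat 1"] exI[of _ 0]) (simp add: one_PGL2[symmetric])
next
  case (Suc n)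
  then obtain B c where B: "invertible B" "proj_class A [^]\<^bsub>PGL2\<^esub> n = proj_class B"
    "B *v v = a ^ n *s v" "B *v w = a ^ n *s w + c *s v" "a * c = of_nat n * a ^ n * b" by blast
  have v: "(B ** A) *v v = a ^ Suc n *s v"
    using B by (simp add: matrix_vector_mul_assoc[symmetric] assms vec.scale)
  have w: "(B ** A) *v w = a ^ Suc n *s w + (a * c + a ^ n * b) *s v"
    using B by (simp add: matrix_vector_mul_assoc[symmetric] assms vec.scale vec.add
        vec.scale_right_distrib vec.scale_left_distrib algebra_simps)
  have "a * (a * c + a ^ n * b) = of_nat (Suc n) * a ^ Suc n * b"
    using B(5) by (simp add: algebra_simps)
  moreover have "proj_class A [^]\<^bsub>PGL2\<^esub> Suc n = proj_class (B ** A)"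
    using B assms by (simp add: mult_PGL2)
  ultimately show ?case using v w B(1) assms(1) invertible_mult by blast
qed

lemma finite_order_unipotent_trivial:
  fixes A :: "'a::field_char_0 ^ 2 ^ 2"
  assumes A: "invertible A" "A *v v = a *s v" "A *v w = a *s w + b *s v"
    and vw: "cross2 v w \<noteq> 0" and N: "proj_class A [^]\<^bsub>PGL2\<^esub> N = \<one>\<^bsub>PGL2\<^esub>" "N > (0::nat)"
  shows "proj_class A = \<one>\<^bsub>PGL2\<^esub>"
proof -
  have v: "v \<noteq> 0" using vw by auto
  have a: "a \<noteq> 0" using invertible_mult_vec_neq_0[OF A(1) v] A(2) by auto
  obtain B c where B: "proj_class A [^]\<^bsub>PGL2\<^esub> N = proj_class B"
    "B *v w = a ^ N *s w + c *s v" "a * c = of_nat N * a ^ N * b"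
    using unipotent_part_of_power[OF A, of N] by blast
  then obtain d where "B = mat d" using N(1) proj_class_eq_one_iff by metis
  then have "d *s w = a ^ N *s w + c *s v" using B(2) by (simp add: mat_vec)
  then have "cross2 (d *s w) w = cross2 (a ^ N *s w + c *s v) w" by simp
  then have "c = 0" using vw by simp
  then have "b = 0" using B(3) a N(2) by simp
  then have "A = mat a"
    using A by (intro matrix_eq_if_on_basis[OF vw]) (simp_all add: mat_vec)
  then show ?thesis using a by (auto simp: proj_class_eq_one_iff)
qed

text \<open>If \<open>l\<close> and \<open>t - l\<close> are the roots of the characteristic polynomial, then
  \<open>(A - l)(A - (t - l)) = 0\<close>. Either the second factor kills a given vector \<open>v\<close>, or its
  value at \<open>v\<close> is an eigenvector for \<open>l\<close>.\<close>

lemma eigenvector_exists: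
  fixes A :: "'a::alg_closed_field ^ 2 ^ 2"
  shows "\<exists>a v. v \<noteq> 0 \<and> A *v v = a *s v"
proof -
  define t where "t = A $ 1 $ 1 + A $ 2 $ 2"
  define d where "d = A $ 1 $ 1 * A $ 2 $ 2 - A $ 1 $ 2 * A $ 2 $ 1"
  obtain l where "poly [:d, - t, 1:] l = 0"
    using alg_closed_imp_poly_has_root[of "[:d, - t, 1:]"] by auto
  then have l: "d = l * (t - l)" by (simp add: algebra_simps eq_neg_iff_add_eq_0)
  define v :: "'a ^ 2" where "v = axis 1 1"
  define u where "u = A *v v - (t - l) *s v"
  have v: "v \<noteq> 0" by (simp add: v_def axis_def vec_eq_iff forall_2)
  \<comment> \<open>Cayley--Hamilton, for the trace \<open>t\<close> and the determinant \<open>d\<close>: applying it to \<open>u\<close> shows that \<open>u\<close> is killed by \<open>A - l\<close>.\<close>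
  have CH: "A *v (A *v v) = t *s (A *v v) - d *s v"
    by (simp add: vec_eq_iff forall_2 matrix_vector_mult_def sum_2 t_def d_def algebra_simps)
  show ?thesis
  proof (cases "u = 0")
    case True
    then have "A *v v = (t - l) *s v" by (simp add: u_def)
    then show ?thesis using v by blast
  next
    case False
    have "A *v u = l *s u"
      unfolding u_def vec.diff CH vec.scale l
      by (simp add: vec_eq_iff algebra_simps)
    then show ?thesis using False by blast
  qed
qed

text \<open>A representing matrix is diagonalisable: it has an eigenvector, and a repeated eigenvalue
  would make it unipotent up to a scalar. The fixed points are the two eigenlines.\<close>

lemma finite_order_two_fixed_points:
  fixes g :: "('a::{alg_closed_field, field_char_0} ^ 2 ^ 2) set"
  assumes g: "g \<in> carrier PGL2" "g \<noteq> \<one>\<^bsub>PGL2\<^esub>"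
    and N: "g [^]\<^bsub>PGL2\<^esub> N = \<one>\<^bsub>PGL2\<^esub>" "N > (0::nat)"
  shows "card {p. pgl_act g p = p} = 2"
proof -
  obtain A where A: "invertible A" "g = proj_class A" using g by (auto simp: carrier_PGL2)
  obtain a v where v: "v \<noteq> 0" "A *v v = a *s v" using eigenvector_exists[of A] by blast
  obtain w where vw: "cross2 v w \<noteq> 0" using exists_cross2_neq_0[OF v(1)] .
  obtain b e where w: "A *v w = e *s w + b *s v"
    using cross2_expand[OF vw, of "A *v w"] by (metis add.commute)
  have ea: "e \<noteq> a"
    using finite_order_unipotent_trivial[OF A(1) v(2) _ vw] w g(2) N A(2) by blast
  \<comment> \<open>Shifting \<open>w\<close> by this multiple of \<open>v\<close> turns it into an eigenvector for \<open>e\<close>.\<close>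
  define k where "k = b / (e - a)"
  define w' where "w' = w + k *s v"
  have k: "b + a * k = e * k" using ea by (simp add: k_def field_simps)
  have "A *v w' = e *s w + (b + a * k) *s v"
    unfolding w'_def vec.add vec.scale v(2) w by (simp add: vec_eq_iff algebra_simps)
  then have w': "A *v w' = e *s w'"
    unfolding k w'_def by (simp add: vec_eq_iff algebra_simps)
  have vw': "cross2 v w' \<noteq> 0" using vw by (simp add: w'_def)
  then have nz: "w' \<noteq> 0" by auto
  have "pgl_act g p = p \<longleftrightarrow> p = proj_pt v \<or> p = proj_pt w'" for p
  proof -
    obtain u where u: "u \<noteq> 0" "p = proj_pt u" by (rule proj_pt_cases)
    define x y where "x = cross2 u w' / cross2 v w'" and "y = cross2 v u / cross2 v w'"
    have uxy: "u = x *s v + y *s w'" using cross2_expand[OF vw', of u] by (simp add: x_def y_def)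
    have Au: "A *v u = (x * a) *s v + (y * e) *s w'"
      by (simp add: uxy vec.add vec.scale v w' mult.commute)
    have "cross2 u (A *v u) = x * y * (e - a) * cross2 v w'"
      unfolding Au by (subst uxy) (simp add: cross2_commute[of w' v] algebra_simps)
    then have "cross2 u (A *v u) = 0 \<longleftrightarrow> y = 0 \<or> x = 0" using ea vw' by auto
    also have "\<dots> \<longleftrightarrow> cross2 v u = 0 \<or> cross2 w' u = 0"
      using vw' by (auto simp: x_def y_def cross2_commute[of w' u])
    also have "\<dots> \<longleftrightarrow> p = proj_pt v \<or> p = proj_pt w'"
      using proj_pt_eq_iff[OF v(1) u(1)] proj_pt_eq_iff[OF nz u(1)] u(2) by auto
    also have "cross2 u (A *v u) = 0 \<longleftrightarrow> pgl_act g p = p"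
      unfolding u(2) A(2) pgl_act_proj_class[OF A(1) u(1)]
      using proj_pt_eq_iff[OF u(1) invertible_mult_vec_neq_0[OF A(1) u(1)]] by metis
    finally show ?thesis .
  qed
  then have "{p. pgl_act g p = p} = {proj_pt v, proj_pt w'}" by auto
  moreover have "proj_pt v \<noteq> proj_pt w'" using proj_pt_eq_iff[OF v(1) nz] vw' by simp
  ultimately show ?thesis by simp
qed

text \<open>When the class \<open>g\<close> fixes the line of \<open>v\<close>, a representing matrix is upper triangular in the
  basis \<open>v, w\<close>, and this is its second diagonal entry divided by the first. The quotient
  depends only on the class; equivalently, it describes the action on a tangent space.\<close>

definition eigenvalue_ratio :: "'a::field ^ 2 \<Rightarrow> 'a ^ 2 \<Rightarrow> ('a ^ 2 ^ 2) set \<Rightarrow> 'a" where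
  "eigenvalue_ratio v w g = (let A = SOME A. A \<in> g in cross2 v (A *v w) / cross2 (A *v v) w)"

lemma eigenvalue_ratio_proj_class:
  "eigenvalue_ratio v w (proj_class A) = cross2 v (A *v w) / cross2 (A *v v) w"
proof -
  have "A \<in> proj_class A" by (auto simp: proj_class_def intro!: exI[of _ 1])
  then have "(SOME B. B \<in> proj_class A) \<in> proj_class A" by (rule someI)
  then show ?thesis by (auto simp: eigenvalue_ratio_def proj_class_def mat_mult_vec)
qed

lemma eigenvalue_ratio_mult:
  assumes vw: "cross2 v w \<noteq> 0"
    and g: "g \<in> carrier PGL2" "pgl_act g (proj_pt v) = proj_pt v"
    and h: "h \<in> carrier PGL2" "pgl_act h (proj_pt v) = proj_pt v"
  shows "eigenvalue_ratio v w (g \<otimes>\<^bsub>PGL2\<^esub> h) = eigenvalue_ratio v w g * eigenvalue_ratio v w h"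
proof -
  have v: "v \<noteq> 0" using vw by auto
  obtain A B where AB: "invertible A" "g = proj_class A" "invertible B" "h = proj_class B"
    using g(1) h(1) by (auto simp: carrier_PGL2)
  obtain a b where a: "a \<noteq> 0" "A *v v = a *s v" and b: "b \<noteq> 0" "B *v v = b *s v"
    using g(2) h(2) pgl_act_fixes_iff[OF _ v] AB by metis
  define e where "e = cross2 v (B *v w) / cross2 v w"
  obtain c where Bw: "B *v w = e *s w + c *s v"
    using cross2_expand[OF vw, of "B *v w"] by (metis add.commute e_def)
  have "cross2 v (A *v (B *v w)) = e * cross2 v (A *v w)"
    unfolding Bw by (simp add: vec.add vec.scale a)
  then show ?thesis
    using AB a b vw
    by (simp add: mult_PGL2 eigenvalue_ratio_proj_class matrix_vector_mul_assoc[symmetric]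
        vec.scale e_def) (simp add: ac_simps)
qed

text \<open>Ratio \<open>1\<close> means equal diagonal entries, and then finite order excludes a nonzero
  entry off the diagonal: on a finite stabiliser the character is faithful.\<close>

lemma eigenvalue_ratio_eq_1D:
  fixes g :: "('a::field_char_0 ^ 2 ^ 2) set"
  assumes vw: "cross2 v w \<noteq> 0"
    and g: "g \<in> carrier PGL2" "pgl_act g (proj_pt v) = proj_pt v"
    and N: "g [^]\<^bsub>PGL2\<^esub> N = \<one>\<^bsub>PGL2\<^esub>" "N > (0::nat)"
    and 1: "eigenvalue_ratio v w g = 1"
  shows "g = \<one>\<^bsub>PGL2\<^esub>"
proof -
  have v: "v \<noteq> 0" using vw by auto
  obtain A where A: "invertible A" "g = proj_class A" using g by (auto simp: carrier_PGL2)
  obtain a where a: "a \<noteq> 0" "A *v v = a *s v"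
    using g(2) pgl_act_fixes_iff[OF A(1) v] A by metis
  have "cross2 v (A *v w) / cross2 v w = a"
    using 1 a vw unfolding A(2) eigenvalue_ratio_proj_class by (simp add: field_simps)
  then have "A *v w = a *s w + (cross2 (A *v w) w / cross2 v w) *s v"
    using cross2_expand[OF vw, of "A *v w"] by (metis add.commute)
  from finite_order_unipotent_trivial[OF A(1) a(2) this vw] N A(2) show ?thesis by simp
qed

lemma finite_subgroup_power_one:
  assumes "subgroup G PGL2" "finite G" "g \<in> G"
  shows "g [^]\<^bsub>PGL2\<^esub> card G = \<one>\<^bsub>PGL2\<^esub>" "card G > 0"
proof -
  interpret P: group PGL2 by (rule group_PGL2)
  interpret H: group "PGL2\<lparr>carrier := G\<rparr>" by (rule subgroup.subgroup_is_group[OF assms(1) group_PGL2])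
  show "g [^]\<^bsub>PGL2\<^esub> card G = \<one>\<^bsub>PGL2\<^esub>"
    using H.pow_order_eq_1[of g] assms(3)
    by (simp add: order_def nat_pow_def)
  show "card G > 0" using assms by (metis card_gt_0_iff empty_iff)
qed

lemma cyclic_if_fixes_point:
  fixes G :: "('a::field_char_0 ^ 2 ^ 2) set set"
  assumes G: "subgroup G PGL2" "finite G" and fix_p: "\<And>g. g \<in> G \<Longrightarrow> pgl_act g p = p"
  shows "cyclic_group (PGL2\<lparr>carrier := G\<rparr>)"
proof -
  interpret P: group PGL2 by (rule group_PGL2)
  interpret S: subgroup G PGL2 by (rule G(1))
  interpret H: group "PGL2\<lparr>carrier := G\<rparr>" by (rule S.subgroup_is_group[OF group_PGL2])
  obtain v where v: "v \<noteq> 0" "p = proj_pt v" by (rule proj_pt_cases)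
  obtain w where vw: "cross2 v w \<noteq> 0" using exists_cross2_neq_0[OF v(1)] .
  let ?\<phi> = "eigenvalue_ratio v w"
  have hom: "?\<phi> (g \<otimes>\<^bsub>PGL2\<^esub> h) = ?\<phi> g * ?\<phi> h" if "g \<in> G" "h \<in> G" for g h
    using that fix_p v by (intro eigenvalue_ratio_mult[OF vw]) auto
  have one: "?\<phi> \<one>\<^bsub>PGL2\<^esub> = 1" using vw by (simp add: one_PGL2 eigenvalue_ratio_proj_class)
  have inj: "inj_on ?\<phi> G"
  proof (rule inj_onI)
    fix g h assume gh: "g \<in> G" "h \<in> G" "?\<phi> g = ?\<phi> h"
    let ?k = "g \<otimes>\<^bsub>PGL2\<^esub> inv\<^bsub>PGL2\<^esub> h"
    have k: "?k \<in> G" "?k \<in> carrier PGL2" using gh by auto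
    have "?\<phi> (h \<otimes>\<^bsub>PGL2\<^esub> inv\<^bsub>PGL2\<^esub> h) = ?\<phi> h * ?\<phi> (inv\<^bsub>PGL2\<^esub> h)" using gh by (intro hom) auto
    then have "?\<phi> ?k = 1" using gh hom[of g "inv\<^bsub>PGL2\<^esub> h"] one by simp
    from eigenvalue_ratio_eq_1D[OF vw k(2) _ finite_subgroup_power_one[OF G k(1)] this]
    have "?k = \<one>\<^bsub>PGL2\<^esub>" using fix_p[OF k(1)] v by simp
    then show "g = h" using gh P.inv_solve_right'[of "\<one>\<^bsub>PGL2\<^esub>" g h] by simp
  qed
  show ?thesis
    by (rule H.cyclic_if_injects_into_field[of ?\<phi>]) (use G hom one inj in auto)
qed

text \<open>In a basis of vectors spanning \<open>p\<close> and \<open>q\<close> the matrix is antidiagonal, so its square is scalar.\<close>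

lemma swap_involution:
  assumes g: "g \<in> carrier PGL2" and pq: "p \<noteq> q" "pgl_act g p = q" "pgl_act g q = p"
  shows "g \<otimes>\<^bsub>PGL2\<^esub> g = \<one>\<^bsub>PGL2\<^esub>"
proof -
  obtain A where A: "invertible A" "g = proj_class A" using g by (auto simp: carrier_PGL2)
  obtain v where v: "v \<noteq> 0" "p = proj_pt v" by (rule proj_pt_cases)
  obtain w where w: "w \<noteq> 0" "q = proj_pt w" by (rule proj_pt_cases)
  have vw: "cross2 v w \<noteq> 0" using pq(1) proj_pt_eq_iff v w by metis
  have nz: "A *v v \<noteq> 0" "A *v w \<noteq> 0" using invertible_mult_vec_neq_0 A v w by blast+
  have "cross2 w (A *v v) = 0" "cross2 v (A *v w) = 0"
    using pq(2,3) v w nz by (simp_all add: A pgl_act_proj_class flip: proj_pt_eq_iff)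
  then obtain b c where bc: "A *v v = b *s w" "A *v w = c *s v"
    using cross2_eq_0_iff v(1) w(1) by metis
  have "A ** A = mat (b * c)"
    by (rule matrix_eq_if_on_basis[OF vw])
       (simp_all add: matrix_vector_mul_assoc[symmetric] bc vec.scale mat_vec mult.commute)
  moreover have "b * c \<noteq> 0" using bc nz by auto
  ultimately show ?thesis
    unfolding A(2) mult_PGL2[OF A(1) A(1)] proj_class_eq_one_iff by blast
qed

section \<open>Invariant pairs of points\<close>

text \<open>The stabiliser \<open>H\<close> of one of the two points is cyclic. If it is not the whole group, its
  complement is a single coset, and consists of elements that swap the two points, hence
  of involutions.\<close>

lemma cyclic_or_dihedral_if_invariant_pair:
  fixes G :: "('a::field_char_0 ^ 2 ^ 2) set set"
  assumes G: "subgroup G PGL2" "finite G" and S: "card S = 2"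
    and inv_S: "\<And>g x. g \<in> G \<Longrightarrow> x \<in> S \<Longrightarrow> pgl_act g x \<in> S"
  shows "cyclic_group (PGL2\<lparr>carrier := G\<rparr>) \<or> is_dihedral (PGL2\<lparr>carrier := G\<rparr>)"
proof -
  interpret P: group PGL2 by (rule group_PGL2)
  interpret S: subgroup G PGL2 by (rule G(1))
  interpret H: group "PGL2\<lparr>carrier := G\<rparr>" by (rule S.subgroup_is_group[OF group_PGL2])
  obtain p q where pq: "S = {p, q}" "p \<noteq> q" using S by (meson card_2_iff)
  have inj: "x = y" if "g \<in> G" "pgl_act g x = pgl_act g y" for g x y
  proof -
    have "pgl_act (inv\<^bsub>PGL2\<^esub> g) (pgl_act g x) = pgl_act (inv\<^bsub>PGL2\<^esub> g) (pgl_act g y)"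
      by (simp only: that(2))
    then show ?thesis unfolding pgl_act_inv[OF S.mem_carrier[OF that(1)]] .
  qed
  have dich: "pgl_act g p = p \<and> pgl_act g q = q \<or> pgl_act g p = q \<and> pgl_act g q = p" if "g \<in> G" for g
    using inv_S[OF that, of p] inv_S[OF that, of q] inj[OF that, of p q] pq by auto
  define H where "H = {g \<in> G. pgl_act g p = p}"
  have HG: "H \<subseteq> G" by (auto simp: H_def)
  have H: "subgroup H PGL2"
  proof (rule P.subgroupI)
    show "H \<subseteq> carrier PGL2" using HG S.subset by blast
    have "\<one>\<^bsub>PGL2\<^esub> \<in> H" by (simp add: H_def pgl_act_one)
    then show "H \<noteq> {}" by blast
    fix g h assume g: "g \<in> H" and h: "h \<in> H"
    show "inv\<^bsub>PGL2\<^esub> g \<in> H" using g pgl_act_inv[of g p] by (auto simp: H_def)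
    show "g \<otimes>\<^bsub>PGL2\<^esub> h \<in> H" using g h by (auto simp: H_def pgl_act_mult)
  qed
  interpret K: group "PGL2\<lparr>carrier := H\<rparr>" by (rule subgroup.subgroup_is_group[OF H group_PGL2])
  show ?thesis
  proof (cases "H = G")
    case True
    then show ?thesis using cyclic_if_fixes_point[OF G, of p] by (auto simp: H_def)
  next
    case False
    then obtain s where s: "s \<in> G" "s \<notin> H" using HG by blast
    have "cyclic_group (PGL2\<lparr>carrier := H\<rparr>)"
      by (rule cyclic_if_fixes_point[OF H finite_subset[OF HG G(2)]]) (auto simp: H_def)
    then obtain r where r: "r \<in> H" and gen: "H = range (\<lambda>i::int. r [^]\<^bsub>PGL2\<lparr>carrier := H\<rparr>\<^esub> i)"
      unfolding K.cyclic_group by auto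
    have rH: "x \<in> H \<longleftrightarrow> (\<exists>i::int. x = r [^]\<^bsub>PGL2\<^esub> i)" for x
      unfolding P.int_pow_consistent[OF H r] using gen by blast
    have rG: "r \<in> G" using r HG by blast
    have pow: "r [^]\<^bsub>PGL2\<lparr>carrier := G\<rparr>\<^esub> i = r [^]\<^bsub>PGL2\<^esub> i" for i :: int
      using P.int_pow_consistent[OF G(1) rG] by simp
    have "is_dihedral (PGL2\<lparr>carrier := G\<rparr>)"
    proof (rule H.dihedral_if_involutions_off_cyclic[of r s])
      show "carrier (PGL2\<lparr>carrier := G\<rparr>) \<subseteq> range (\<lambda>i::int. r [^]\<^bsub>PGL2\<lparr>carrier := G\<rparr>\<^esub> i) \<union>
          range (\<lambda>i::int. r [^]\<^bsub>PGL2\<lparr>carrier := G\<rparr>\<^esub> i \<otimes>\<^bsub>PGL2\<lparr>carrier := G\<rparr>\<^esub> s)"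
      proof
        fix x assume "x \<in> carrier (PGL2\<lparr>carrier := G\<rparr>)"
        then have x: "x \<in> G" by simp
        show "x \<in> range (\<lambda>i::int. r [^]\<^bsub>PGL2\<lparr>carrier := G\<rparr>\<^esub> i) \<union>
            range (\<lambda>i::int. r [^]\<^bsub>PGL2\<lparr>carrier := G\<rparr>\<^esub> i \<otimes>\<^bsub>PGL2\<lparr>carrier := G\<rparr>\<^esub> s)"
        proof (cases "x \<in> H")
          case True
          then show ?thesis using rH[of x] pow by auto
        next
          case False
          then have xq: "pgl_act x q = p" using dich[OF x] x by (auto simp: H_def)
          have "pgl_act s q = p" using dich[OF s(1)] s by (auto simp: H_def)
          then have "pgl_act (inv\<^bsub>PGL2\<^esub> s) p = q" using pgl_act_inv[of s q] s(1) by auto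
          then have "x \<otimes>\<^bsub>PGL2\<^esub> inv\<^bsub>PGL2\<^esub> s \<in> H" using x s xq by (auto simp: H_def pgl_act_mult)
          then obtain i :: int where "x \<otimes>\<^bsub>PGL2\<^esub> inv\<^bsub>PGL2\<^esub> s = r [^]\<^bsub>PGL2\<^esub> i" using rH by blast
          then have "x = r [^]\<^bsub>PGL2\<^esub> i \<otimes>\<^bsub>PGL2\<^esub> s"
            using x s(1) rG P.inv_solve_right[of "r [^]\<^bsub>PGL2\<^esub> i" x s] by simp
          then show ?thesis using pow by auto
        qed
      qed
      fix i :: int
      let ?y = "r [^]\<^bsub>PGL2\<^esub> i \<otimes>\<^bsub>PGL2\<^esub> s"
      have ri: "r [^]\<^bsub>PGL2\<^esub> i \<in> H" using rH by blast
      then have y: "?y \<in> G" using HG s by auto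
      have "pgl_act ?y p = q" using ri dich[of "r [^]\<^bsub>PGL2\<^esub> i"] dich[of s] s pq HG
        by (auto simp: H_def pgl_act_mult)
      then have "?y \<otimes>\<^bsub>PGL2\<^esub> ?y = \<one>\<^bsub>PGL2\<^esub>" using swap_involution[of ?y p q] y dich[OF y] pq by auto
      then show "(r [^]\<^bsub>PGL2\<lparr>carrier := G\<rparr>\<^esub> i \<otimes>\<^bsub>PGL2\<lparr>carrier := G\<rparr>\<^esub> s) \<otimes>\<^bsub>PGL2\<lparr>carrier := G\<rparr>\<^esub>
          (r [^]\<^bsub>PGL2\<lparr>carrier := G\<rparr>\<^esub> i \<otimes>\<^bsub>PGL2\<lparr>carrier := G\<rparr>\<^esub> s) = \<one>\<^bsub>PGL2\<lparr>carrier := G\<rparr>\<^esub>"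
        by (simp add: pow)
    qed (use G rG s rH pow in auto)
    then show ?thesis ..
  qed
qed

text \<open>Each \<open>g\<close> conjugates \<open>t\<close> to \<open>t\<close> or to its inverse, which has the same fixed points;
  hence \<open>g\<close> permutes the two fixed points of \<open>t\<close>.\<close>

lemma invariant_pair_if_quasi_central:
  fixes G :: "('a::{alg_closed_field, field_char_0} ^ 2 ^ 2) set set"
  assumes G: "subgroup G PGL2" "finite G" and t: "t \<in> G" "t \<noteq> \<one>\<^bsub>PGL2\<^esub>"
    and central: "\<And>g. g \<in> G \<Longrightarrow> t \<otimes>\<^bsub>PGL2\<^esub> g = g \<otimes>\<^bsub>PGL2\<^esub> t \<or> t \<otimes>\<^bsub>PGL2\<^esub> g \<otimes>\<^bsub>PGL2\<^esub> t = g"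
  shows "\<exists>S :: 'a proj_line set. card S = 2 \<and> (\<forall>g\<in>G. \<forall>x\<in>S. pgl_act g x \<in> S)"
proof (intro exI conjI ballI)
  interpret P: group PGL2 by (rule group_PGL2)
  interpret S: subgroup G PGL2 by (rule G(1))
  show "card {p. pgl_act t p = p} = 2"
    by (rule finite_order_two_fixed_points[OF _ t(2) finite_subgroup_power_one[OF G t(1)]])
       (use t in auto)
  fix g p assume g: "g \<in> G" and "p \<in> {p. pgl_act t p = p}"
  then have p: "pgl_act t p = p" by simp
  have "pgl_act t (pgl_act g p) = pgl_act (t \<otimes>\<^bsub>PGL2\<^esub> g) p"
    "pgl_act t (pgl_act g p) = pgl_act (t \<otimes>\<^bsub>PGL2\<^esub> g \<otimes>\<^bsub>PGL2\<^esub> t) p"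
    "pgl_act g p = pgl_act (g \<otimes>\<^bsub>PGL2\<^esub> t) p"
    using g t p by (simp_all add: pgl_act_mult)
  then show "pgl_act g p \<in> {p. pgl_act t p = p}" using central[OF g] by auto
qed

lemma proj_line_infinite: "infinite (UNIV :: 'a::field_char_0 proj_line set)"
proof -
  have "inj (\<lambda>a::'a. proj_pt (vector [a, 1]))"
  proof (rule injI)
    fix a b :: 'a assume "proj_pt (vector [a, 1]) = proj_pt (vector [b, 1])"
    then show "a = b"
      by (subst (asm) proj_pt_eq_iff) (auto simp: vec_eq_iff forall_2 cross2_def)
  qed
  then show ?thesis by (metis finite_imageD finite_subset infinite_UNIV_char_0 subset_UNIV)
qed

lemma invariant_pair_if_cyclic_or_dihedral:
  fixes G :: "('a::{alg_closed_field, field_char_0} ^ 2 ^ 2) set set"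
  assumes G: "subgroup G PGL2" "finite G"
    and cd: "cyclic_group (PGL2\<lparr>carrier := G\<rparr>) \<or> is_dihedral (PGL2\<lparr>carrier := G\<rparr>)"
  shows "\<exists>S :: 'a proj_line set. card S = 2 \<and> (\<forall>g\<in>G. \<forall>x\<in>S. pgl_act g x \<in> S)"
proof (cases "G = {\<one>\<^bsub>PGL2\<^esub>}")
  case True
  obtain S :: "'a proj_line set" where "card S = 2"
    using infinite_arbitrarily_large[OF proj_line_infinite] by blast
  then show ?thesis using True by (auto simp: pgl_act_one)
next
  case False
  interpret P: group PGL2 by (rule group_PGL2)
  interpret S: subgroup G PGL2 by (rule G(1))
  interpret H: group "PGL2\<lparr>carrier := G\<rparr>" by (rule S.subgroup_is_group[OF group_PGL2])
  from cd show ?thesis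
  proof
    assume "cyclic_group (PGL2\<lparr>carrier := G\<rparr>)"
    then interpret C: comm_group "PGL2\<lparr>carrier := G\<rparr>" by (rule H.cyclic_imp_abelian_group)
    obtain t where "t \<in> G" "t \<noteq> \<one>\<^bsub>PGL2\<^esub>" using False S.one_closed by blast
    then show ?thesis using C.m_comm by (intro invariant_pair_if_quasi_central[OF G]) auto
  next
    assume "is_dihedral (PGL2\<lparr>carrier := G\<rparr>)"
    then obtain n where n: "n \<ge> 1" "PGL2\<lparr>carrier := G\<rparr> \<cong> dihedral_group n"
      by (auto simp: is_dihedral_def)
    interpret D: group "dihedral_group n" by (rule group_dihedral_group[OF n(1)])
    obtain f where f: "f \<in> iso (dihedral_group n) (PGL2\<lparr>carrier := G\<rparr>)"
      using H.iso_sym[OF n(2)] by (auto simp: is_iso_def)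
    \<comment> \<open>A generating rotation is inverted by every reflection; for \<open>n = 1\<close> it is trivial, and the reflection is central.\<close>
    define \<tau> :: "int \<times> bool" where "\<tau> = (if n = 1 then (0, True) else (1, False))"
    have \<tau>: "\<tau> \<in> carrier (dihedral_group n)" "\<tau> \<noteq> \<one>\<^bsub>dihedral_group n\<^esub>"
      using n(1) by (auto simp: \<tau>_def dihedral_group_def)
    have central: "\<tau> \<otimes>\<^bsub>dihedral_group n\<^esub> x = x \<otimes>\<^bsub>dihedral_group n\<^esub> \<tau> \<or>
        \<tau> \<otimes>\<^bsub>dihedral_group n\<^esub> x \<otimes>\<^bsub>dihedral_group n\<^esub> \<tau> = x" if "x \<in> carrier (dihedral_group n)" for x
      using that by (cases x; cases "snd x") (auto simp: \<tau>_def dihedral_group_def mod_simps add.commute)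
    have hom: "f (x \<otimes>\<^bsub>dihedral_group n\<^esub> y) = f x \<otimes>\<^bsub>PGL2\<^esub> f y"
      if "x \<in> carrier (dihedral_group n)" "y \<in> carrier (dihedral_group n)" for x y
      using hom_mult[OF Group.iso_imp_homomorphism[OF f] that] by simp
    have bij: "bij_betw f (carrier (dihedral_group n)) G" using f by (simp add: iso_def)
    have "f \<one>\<^bsub>dihedral_group n\<^esub> = \<one>\<^bsub>PGL2\<^esub>"
      using hom_one[OF Group.iso_imp_homomorphism[OF f] D.is_group H.is_group] by simp
    then have t: "f \<tau> \<in> G" "f \<tau> \<noteq> \<one>\<^bsub>PGL2\<^esub>"
      using bij \<tau> D.one_closed by (auto simp: bij_betw_def inj_on_def)
    show ?thesis
    proof (rule invariant_pair_if_quasi_central[OF G t])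
      fix g assume "g \<in> G"
      then obtain x where x: "x \<in> carrier (dihedral_group n)" "g = f x"
        using bij by (auto simp: bij_betw_def)
      show "f \<tau> \<otimes>\<^bsub>PGL2\<^esub> g = g \<otimes>\<^bsub>PGL2\<^esub> f \<tau> \<or> f \<tau> \<otimes>\<^bsub>PGL2\<^esub> g \<otimes>\<^bsub>PGL2\<^esub> f \<tau> = g"
        using central[OF x(1)] x \<tau>(1) D.m_closed hom by metis
    qed
  qed
qed

section \<open>Anticanonical divisors and dual complexes on the projective line\<close>

lemma pt_eq_proj_pt: "pt a = proj_pt (vector [a, 1])" "pt_inf = proj_pt (vector [1, 0])"
  by (simp_all add: pt_def pt_inf_def proj_pt_def)

lemma vector_neq_0: "vector [a, 1] \<noteq> (0 :: 'a::field ^ 2)" "vector [1, 0] \<noteq> (0 :: 'a ^ 2)"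
  by (auto simp: vec_eq_iff forall_2)

lemma pt_eq_iff [simp]: "pt a = pt b \<longleftrightarrow> a = b"
  unfolding pt_eq_proj_pt by (subst proj_pt_eq_iff) (simp_all add: vector_neq_0 cross2_def)

lemma pt_neq_inf [simp]: "pt a \<noteq> pt_inf" "pt_inf \<noteq> pt a"
proof -
  show "pt a \<noteq> pt_inf" unfolding pt_eq_proj_pt
    by (subst proj_pt_eq_iff) (simp_all add: vector_neq_0 cross2_def)
  then show "pt_inf \<noteq> pt a" by metis
qed

lemma proj_line_cases:
  obtains "p = pt_inf" | a where "p = pt a"
proof -
  obtain v where v: "v \<noteq> 0" "p = proj_pt v" by (rule proj_pt_cases)
  show thesis
  proof (cases "v $ 2 = 0")
    case True
    then have "p = pt_inf" unfolding v(2) pt_eq_proj_pt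
      by (subst proj_pt_eq_iff) (simp_all add: v(1) vector_neq_0 cross2_def)
    then show ?thesis by (rule that)
  next
    case False
    then have "p = pt (v $ 1 / v $ 2)" unfolding v(2) pt_eq_proj_pt
      by (subst proj_pt_eq_iff) (simp_all add: v(1) vector_neq_0 cross2_def)
    then show ?thesis by (rule that)
  qed
qed

lemma affine_coord_pt [simp]: "affine_coord (pt a) = a"
  by (simp add: affine_coord_def)

lemma ord_at_pt:
  assumes "p \<noteq> 0" "q \<noteq> 0"
  shows "ord_at (pt a) (Fract p q) = int (Polynomial.order a p) - int (Polynomial.order a q)"
proof -
  have "ord_finite a (Fract p q) = int (Polynomial.order a p) - int (Polynomial.order a q)"
    using assms by (simp add: Fraction_Field.Fract_def ord_finite.abs_eq)
  then show ?thesis by (simp add: ord_at_def)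
qed

lemma ord_at_pt_inf:
  assumes "p \<noteq> 0" "q \<noteq> 0"
  shows "ord_at pt_inf (Fract p q) = int (degree q) - int (degree p)"
proof -
  have "ord_infinity (Fract p q) = int (degree q) - int (degree p)"
    using assms by (simp add: Fraction_Field.Fract_def ord_infinity.abs_eq)
  then show ?thesis by (simp add: ord_at_def)
qed

lemma fract_deriv_Fract:
  assumes "q \<noteq> 0"
  shows "fract_deriv (Fract p q) = Fract (pderiv p * q - p * pderiv q) (q * q)"
  using assms by (simp add: Fraction_Field.Fract_def fract_deriv.abs_eq)

text \<open>Since \<open>dx\<close> equals \<open>- x ^ 2\<close> times the differential of the parameter \<open>1 / x\<close>, it has a double pole
  at infinity.\<close>

lemma K_P1_eq: "K_P1 p = (if p = pt_inf then -2 else 0)"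
proof (cases p rule: proj_line_cases)
  case 1
  have "fract_deriv (local_param p) = Fract [:- 1:] [:0, 0, 1:]"
    using 1 by (simp add: local_param_def fract_deriv_Fract pderiv_pCons)
  then have "1 / fract_deriv (local_param p) = Fract [:0, 0, 1:] [:- 1:]"
    by (simp add: One_fract_def)
  then show ?thesis using 1 by (simp add: K_P1_def ord_diff_def ord_at_pt_inf)
next
  case (2 a)
  have "fract_deriv (local_param p) = 1"
    using 2 by (simp add: local_param_def fract_deriv_Fract pderiv_pCons One_fract_def one_pCons)
  then show ?thesis using 2 ord_at_pt[of 1 1 a]
    by (simp add: K_P1_def ord_diff_def One_fract_def[symmetric])
qed

lemma sum_order_eq_degree:
  fixes p :: "'a::alg_closed_field poly"
  assumes p: "p \<noteq> 0" and R: "finite R" "{a. poly p a = 0} \<subseteq> R"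
  shows "(\<Sum>a\<in>R. Polynomial.order a p) = degree p"
proof -
  obtain A where A: "size A = degree p" "p = Polynomial.smult (lead_coeff p) (\<Prod>x\<in>#A. [:-x, 1:])"
    using alg_closed_imp_factorization[OF p] by blast
  have nz: "(\<Prod>x\<in>#B. [:-x, 1:]) \<noteq> 0" for B :: "'a multiset"
    by (induction B) (simp_all del: mult_pCons_left)
  have "proots (\<Prod>x\<in>#B. [:-x, 1:]) = B" for B :: "'a multiset"
  proof (induction B)
    case (add x B)
    have "proots ([:-x, 1:] * (\<Prod>x\<in>#B. [:-x, 1:])) = {#x#} + B"
      by (subst proots_mult[OF _ nz]) (simp_all add: add.IH)
    then show ?case by (simp del: mult_pCons_left)
  qed simp
  moreover have "proots p = proots (\<Prod>x\<in>#A. [:-x, 1:])"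
    using p by (subst A(2)) (simp del: mult_pCons_left)
  ultimately have "size (proots p) = degree p" using A(1) by simp
  then have "degree p = (\<Sum>a | poly p a = 0. Polynomial.order a p)"
    using p by (simp add: size_multiset_overloaded_eq)
  also have "\<dots> = (\<Sum>a\<in>R. Polynomial.order a p)"
    using R p by (intro sum.mono_neutral_left) (auto simp: order_gt_0_iff)
  finally show ?thesis ..
qed

text \<open>Over an algebraically closed field a principal divisor has degree \<open>0\<close>, so every member of
  the system has the degree \<open>2 l\<close> of the divisor \<open>- l K\<close>; it is effective, so partial sums
  are no larger.\<close>

lemma sum_anticanonical_le:
  fixes M :: "'a::alg_closed_field proj_line \<Rightarrow> int"
  assumes M: "M \<in> complete_linear_system (\<lambda>p. - int l * K_P1 p)" and S: "finite S"
  shows "(\<Sum>p\<in>S. M p) \<le> 2 * int l"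
proof -
  have nonneg: "M p \<ge> 0" for p using M by (simp add: complete_linear_system_def)
  obtain f where f: "f \<noteq> 0" "\<And>p. M p + int l * K_P1 p = ord_at p f"
    using M by (auto simp: complete_linear_system_def lin_equiv_def)
  obtain P Q where PQ: "f = Fract P Q" "Q \<noteq> 0" by (cases f) auto
  then have P: "P \<noteq> 0" using f(1) by (auto simp: fract_collapse)
  have Minf: "M pt_inf = 2 * int l + int (degree Q) - int (degree P)"
    using f(2)[of pt_inf] by (simp add: K_P1_eq PQ(1) ord_at_pt_inf P PQ(2))
  have Mpt: "M (pt a) = int (Polynomial.order a P) - int (Polynomial.order a Q)" for a
    using f(2)[of "pt a"] by (simp add: K_P1_eq PQ(1) ord_at_pt P PQ(2))
  define R where "R = {a. poly P a = 0} \<union> {a. poly Q a = 0}"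
  have R: "finite R" using P PQ(2) by (simp add: R_def poly_roots_finite)
  have out: "M p = 0" if "p \<notin> insert pt_inf (pt ` R)" for p
  proof (cases p rule: proj_line_cases)
    case (2 a)
    then have "poly P a \<noteq> 0" "poly Q a \<noteq> 0" using that by (auto simp: R_def)
    then show ?thesis using 2 by (simp add: Mpt order_0I)
  qed (use that in simp)
  have "(\<Sum>p\<in>S. M p) \<le> (\<Sum>p\<in>S \<union> insert pt_inf (pt ` R). M p)"
    using S R nonneg by (intro sum_mono2) auto
  also have "\<dots> = (\<Sum>p\<in>insert pt_inf (pt ` R). M p)"
    using S R out by (intro sum.mono_neutral_right) auto
  also have "\<dots> = M pt_inf + (\<Sum>a\<in>R. M (pt a))"
    using R by (subst sum.insert) (auto simp: sum.reindex inj_on_def)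
  also have "(\<Sum>a\<in>R. M (pt a)) = int (\<Sum>a\<in>R. Polynomial.order a P) - int (\<Sum>a\<in>R. Polynomial.order a Q)"
    by (simp add: Mpt sum_subtractf)
  also have "\<dots> = int (degree P) - int (degree Q)"
    using sum_order_eq_degree[OF P R] sum_order_eq_degree[OF PQ(2) R] by (simp add: R_def)
  finally show ?thesis using Minf by simp
qed

lemma card_coeff_one_le:
  fixes D :: "'a::alg_closed_field proj_line \<Rightarrow> rat"
  assumes D: "D \<in> anticanonical_Q_system l" and l: "l \<ge> 1"
    and S: "finite S" "\<And>p. p \<in> S \<Longrightarrow> D p = 1"
  shows "card S \<le> 2"
proof -
  obtain M where M: "M \<in> complete_linear_system (\<lambda>p. - int l * K_P1 p)"
    "\<And>p. D p = of_int (M p) / of_nat l"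
    using D by (auto simp: anticanonical_Q_system_def)
  have "M p = int l" if "p \<in> S" for p
  proof -
    have "(of_int (M p) :: rat) = of_int (int l)" using M(2)[of p] S(2)[OF that] l by simp
    then show ?thesis by (simp only: of_int_eq_iff)
  qed
  then have "int (card S) * int l = (\<Sum>p\<in>S. M p)" by simp
  also have "\<dots> \<le> 2 * int l" by (rule sum_anticanonical_le[OF M(1) S(1)])
  finally show ?thesis using l by simp
qed

lemma order_prod_linear_factors:
  fixes a :: "'a::field"
  assumes "finite A"
  shows "Polynomial.order a (\<Prod>b\<in>A. [:- b, 1:]) = (if a \<in> A then 1 else 0)"
proof -
  have 1: "Polynomial.order a [:- b, 1:] = (if a = b then 1 else 0)" for b
    by (metis count_proots count_single one_pCons pCons_eq_0_iff minus_minus proots_linear_factor zero_neq_one)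
  have "Polynomial.order a (\<Prod>b\<in>A. [:- b, 1:]) = (\<Sum>b\<in>A. Polynomial.order a [:- b, 1:])"
    using assms
  proof (induction A rule: finite_induct)
    case (insert b A)
    have "(\<Prod>b\<in>A. [:- b, 1:]) \<noteq> 0" using insert(1) by simp
    then have nz: "[:- b, 1:] * (\<Prod>b\<in>A. [:- b, 1:]) \<noteq> 0"
      by (simp only: mult_eq_0_iff pCons_eq_0_iff one_neq_zero simp_thms)
    show ?case unfolding prod.insert[OF insert(1,2)] sum.insert[OF insert(1,2)]
      by (simp only: order_mult[OF nz] insert(3))
  qed simp
  then show ?thesis using assms by (simp add: 1)
qed

text \<open>All points are linearly equivalent, so twice the sum of the \<open>l = card S\<close> points lies in
  \<open>| - l K |\<close>; the polynomial with simple roots at the affine points of \<open>S\<close> gives the equivalence.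
  Having at least two points keeps the coefficients \<open>2 / l\<close> at most \<open>1\<close>.\<close>

lemma equidistributed_pair:
  fixes S :: "'a::field proj_line set"
  assumes S: "finite S" "card S \<ge> 2"
  defines "D \<equiv> \<lambda>p. if p \<in> S then 2 / of_nat (card S) else (0 :: rat)"
  shows "D \<in> anticanonical_Q_system (card S)" "log_pair D"
proof -
  let ?l = "card S"
  define M where "M = (\<lambda>p. if p \<in> S then 2 else 0 :: int)"
  have DM: "D p = of_int (M p) / of_nat ?l" for p by (simp add: D_def M_def)
  define R where "R = {a. pt a \<in> S}"
  have R: "finite R" "card S = card R + (if pt_inf \<in> S then 1 else 0)"
  proof -
    have eq: "S = pt ` R \<union> (if pt_inf \<in> S then {pt_inf} else {})"
    proof (rule Set.set_eqI)
      fix p show "p \<in> S \<longleftrightarrow> p \<in> pt ` R \<union> (if pt_inf \<in> S then {pt_inf} else {})"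
        by (cases p rule: proj_line_cases) (auto simp: R_def)
    qed
    have "finite (pt ` R)" using S(1) finite_subset[of "pt ` R" S] by (auto simp: R_def)
    then show fin: "finite R" by (rule finite_imageD) (simp add: inj_on_def)
    have "card (pt ` R) = card R" by (rule card_image) (simp add: inj_on_def)
    moreover have "card S = card (pt ` R) + card (if pt_inf \<in> S then {pt_inf :: 'a proj_line} else {})"
      by (subst eq, rule card_Un_disjoint) (use fin in auto)
    ultimately show "card S = card R + (if pt_inf \<in> S then 1 else 0)" by auto
  qed
  define P :: "'a poly" where "P = (\<Prod>b\<in>R. [:- b, 1:])"
  have P: "P \<noteq> 0" using R(1) by (simp add: P_def)
  have degP: "degree P = card R" by (simp add: P_def degree_prod_sum_eq)
  have div: "M p + int ?l * K_P1 p = ord_at p (Fract (P * P) 1)" for p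
  proof (cases p rule: proj_line_cases)
    case 1
    then show ?thesis using P R(2) by (simp add: ord_at_pt_inf degree_mult_eq degP M_def K_P1_eq)
  next
    case (2 a)
    then show ?thesis using P R
      by (simp add: ord_at_pt order_mult M_def K_P1_eq R_def[symmetric])
         (simp add: P_def order_prod_linear_factors R_def)
  qed
  have nz: "Fract (P * P) 1 \<noteq> 0" using P by (simp add: Zero_fract_def eq_fract)
  have "lin_equiv M (\<lambda>p. - int ?l * K_P1 p)"
    unfolding lin_equiv_def using div nz by (intro exI[of _ "Fract (P * P) 1"]) simp
  moreover have "is_divisor M" using S(1) by (simp add: is_divisor_def M_def)
  ultimately have "M \<in> complete_linear_system (\<lambda>p. - int ?l * K_P1 p)"
    by (simp add: complete_linear_system_def M_def)
  then show "D \<in> anticanonical_Q_system ?l" using DM by (auto simp: anticanonical_Q_system_def)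
  have l0: "of_nat ?l \<noteq> (0 :: rat)" using S(2) by (metis not_numeral_le_zero of_nat_eq_0_iff)
  \<comment> \<open>The divisor \<open>l (K + D)\<close> is principal, so one function serves as equation on the whole line.\<close>
  have "cartier (\<lambda>p. M p + int ?l * K_P1 p)"
    unfolding cartier_def
    by (intro allI exI[of _ UNIV] exI[of _ "Fract (P * P) 1"]) (use div nz in \<open>simp add: zariski_closed_def\<close>)
  moreover have "of_nat ?l * (of_int (K_P1 p) + D p) = of_int (M p + int ?l * K_P1 p)" for p
    unfolding DM using l0 by (simp add: field_simps)
  ultimately have "Q_cartier (\<lambda>p. of_int (K_P1 p) + D p)"
    unfolding Q_cartier_def using S(2)
    by (intro exI[of _ ?l] conjI exI[of _ "\<lambda>p. M p + int ?l * K_P1 p"]) auto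
  moreover have "is_divisor D" using S by (simp add: is_divisor_def D_def)
  moreover have "0 \<le> D p \<and> D p \<le> 1" for p using S by (simp add: D_def divide_simps)
  ultimately show "log_pair D" by (simp add: log_pair_def)
qed

lemma irreducible_component_singleton: "irreducible_component_of {p} {p}"
  by (auto simp: irreducible_component_of_def zariski_irreducible_def)

text \<open>Distinct points do not meet, so the dual complex is a set of isolated vertices.\<close>

lemma dual_cells_nonempty_iff:
  assumes "k \<ge> 1"
  shows "dual_cells D k \<noteq> {} \<longleftrightarrow> k = 1 \<and> (\<exists>p. D p = 1)"
proof
  assume "dual_cells D k \<noteq> {}"
  then obtain C Z where C: "C \<subseteq> coeff_one_components D" "finite C" "card C = k"
    and Z: "irreducible_component_of (\<Inter>C) Z"
    by (auto simp: dual_cells_def)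
  have "\<Inter>C \<noteq> {}" using Z by (auto simp: irreducible_component_of_def zariski_irreducible_def)
  then obtain x where "\<And>c. c \<in> C \<Longrightarrow> x \<in> c" by auto
  then have sub: "C \<subseteq> {{x}}" using C(1) by (force simp: coeff_one_components_def)
  have "C \<noteq> {}" using C(3) assms by auto
  then have "C = {{x}}" using sub by auto
  then show "k = 1 \<and> (\<exists>p. D p = 1)"
    using C by (auto simp: coeff_one_components_def log_resolution_divisor_def)
next
  assume "k = 1 \<and> (\<exists>p. D p = 1)"
  then obtain p where "k = 1" "D p = 1" by blast
  then have "({{p}}, {p}) \<in> dual_cells D k"
    by (auto simp: dual_cells_def coeff_one_components_def log_resolution_divisor_def
          irreducible_component_singleton)
  then show "dual_cells D k \<noteq> {}" by blast
qed

lemma dim_dual_complex_eq: "dim_dual_complex D = (if \<exists>p. D p = 1 then 0 else -1)"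
proof -
  have "{k. k \<ge> 1 \<and> dual_cells D k \<noteq> {}} = (if \<exists>p. D p = 1 then {1} else {})"
    using dual_cells_nonempty_iff[of _ D] by auto
  then show ?thesis by (simp add: dim_dual_complex_def Let_def)
qed

section \<open>The coregularity\<close>

text \<open>The pairs in the definition of \<open>reg_l\<close>, that is, the invariant log canonical
  pairs with \<open>l (K + D)\<close> linearly trivial.\<close>

definition log_CY_pairs :: "('a::field ^ 2 ^ 2) set set \<Rightarrow> nat \<Rightarrow> ('a proj_line \<Rightarrow> rat) set" where
  "log_CY_pairs G l = {D. log_pair D \<and> lc D \<and> invariant_divisor G D \<and> D \<in> anticanonical_Q_system l}"

lemma reg_l_eq: "reg_l G l = (SUP D\<in>log_CY_pairs G l. if \<exists>p. D p = 1 then 0 else -1)"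
proof -
  have "ereal (real_of_int (dim_dual_complex D)) = (if \<exists>p. D p = 1 then 0 else -1)"
    for D :: "'a proj_line \<Rightarrow> rat"
    by (simp add: dim_dual_complex_eq one_ereal_def)
  then show ?thesis by (simp add: reg_l_def log_CY_pairs_def)
qed

text \<open>A pair with a coefficient \<open>1\<close> has regularity \<open>0\<close>, every other pair \<open>-1\<close>. The given pair
  \<open>D0\<close> excludes the supremum \<open>- \<infinity>\<close> of an empty family.\<close>

lemma coreg_eq:
  assumes "l0 \<ge> 1" "D0 \<in> log_CY_pairs G l0"
  shows "coreg G = (if \<exists>l\<ge>1. \<exists>D\<in>log_CY_pairs G l. \<exists>p. D p = 1 then 0 else 1)"
proof (cases "\<exists>l\<ge>1. \<exists>D\<in>log_CY_pairs G l. \<exists>p. D p = 1")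
  case True
  then obtain l D where l: "l \<ge> 1" "D \<in> log_CY_pairs G l" "\<exists>p. D p = 1" by blast
  have "reg_l G k \<le> 0" for k unfolding reg_l_eq by (rule SUP_least) simp
  then have "reg G \<le> 0" unfolding reg_def by (rule SUP_least)
  moreover have "0 \<le> reg_l G l" unfolding reg_l_eq using l by (intro SUP_upper2[of D]) auto
  then have "0 \<le> reg G" unfolding reg_def using l(1) by (intro SUP_upper2[of l]) auto
  ultimately have "reg G = 0" by (rule antisym)
  then have "coreg G = 0" by (simp add: coreg_def dim_P1_def)
  then show ?thesis using True by simp
next
  case False
  have "reg_l G k \<le> -1" if "k \<ge> 1" for k
    unfolding reg_l_eq by (rule SUP_least) (use that False in auto)
  then have "reg G \<le> -1" unfolding reg_def by (intro SUP_least) auto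
  moreover have "-1 \<le> reg_l G l0"
    unfolding reg_l_eq using assms by (intro SUP_upper2[of D0]) auto
  then have "-1 \<le> reg G" unfolding reg_def using assms(1) by (intro SUP_upper2[of l0]) auto
  ultimately have "reg G = -1" by (rule antisym)
  then have "coreg G = 1" by (simp add: coreg_def dim_P1_def)
  then show ?thesis using False by simp
qed

lemma invariant_set_log_CY_pair:
  assumes G: "subgroup G PGL2" and S: "finite S" "card S \<ge> 2"
    and inv: "\<And>g x. g \<in> G \<Longrightarrow> x \<in> S \<Longrightarrow> pgl_act g x \<in> S"
  shows "(\<lambda>p. if p \<in> S then 2 / of_nat (card S) else 0) \<in> log_CY_pairs G (card S)"
proof -
  let ?D = "\<lambda>p. if p \<in> S then 2 / of_nat (card S) else (0 :: rat)"
  have "pgl_act g p \<in> S \<longleftrightarrow> p \<in> S" if g: "g \<in> G" for g p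
  proof
    assume "pgl_act g p \<in> S"
    then have "pgl_act (inv\<^bsub>PGL2\<^esub> g) (pgl_act g p) \<in> S"
      using inv subgroup.m_inv_closed[OF G g] by blast
    then show "p \<in> S" using pgl_act_inv subgroup.mem_carrier[OF G g] by metis
  qed (rule inv[OF g])
  then have "invariant_divisor G ?D" by (simp add: invariant_divisor_def)
  moreover note pair = equidistributed_pair[OF S]
  moreover have "lc ?D" using pair(2) by (simp add: lc_def log_pair_def log_resolution_divisor_def)
  ultimately show ?thesis by (simp add: log_CY_pairs_def)
qed

text \<open>The union of the orbits of two distinct points is a finite invariant set with at least two points.\<close>

lemma log_CY_pair_exists:
  fixes G :: "('a::field_char_0 ^ 2 ^ 2) set set"
  assumes G: "subgroup G PGL2" "finite G"
  shows "\<exists>l\<ge>1. log_CY_pairs G l \<noteq> {}"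
proof -
  interpret S: subgroup G PGL2 by (rule G(1))
  obtain T :: "'a proj_line set" where T: "card T = 2"
    using infinite_arbitrarily_large[OF proj_line_infinite] by blast
  have finT: "finite T" using T by (metis card.infinite zero_neq_numeral)
  define S where "S = (\<Union>g\<in>G. pgl_act g ` T)"
  have fin: "finite S" using G(2) finT by (simp add: S_def)
  have "T = pgl_act \<one>\<^bsub>PGL2\<^esub> ` T" by (simp add: pgl_act_one)
  then have "T \<subseteq> S" unfolding S_def using S.one_closed by blast
  then have card: "card S \<ge> 2" using card_mono[OF fin] T by metis
  have "pgl_act g x \<in> S" if "g \<in> G" "x \<in> S" for g x
  proof -
    obtain h t where h: "h \<in> G" "t \<in> T" "x = pgl_act h t" using \<open>x \<in> S\<close> by (auto simp: S_def)
    then have "pgl_act g x = pgl_act (g \<otimes>\<^bsub>PGL2\<^esub> h) t" using \<open>g \<in> G\<close> by (simp add: pgl_act_mult)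
    then show ?thesis unfolding S_def using h \<open>g \<in> G\<close> S.m_closed by blast
  qed
  from invariant_set_log_CY_pair[OF G(1) fin card this] show ?thesis
    using card by (intro exI[of _ "card S"]) auto
qed

text \<open>By invariance \<open>D\<close> has coefficient \<open>1\<close> along the whole orbit of \<open>p\<close>. Since \<open>D\<close> has
  degree \<open>2\<close>, the orbit is a fixed point or an invariant pair.\<close>

lemma cyclic_or_dihedral_if_coeff_one:
  fixes G :: "('a::{alg_closed_field, field_char_0} ^ 2 ^ 2) set set"
  assumes G: "subgroup G PGL2" "finite G"
    and D: "l \<ge> 1" "D \<in> log_CY_pairs G l" "D p = 1"
  shows "cyclic_group (PGL2\<lparr>carrier := G\<rparr>) \<or> is_dihedral (PGL2\<lparr>carrier := G\<rparr>)"
proof -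
  interpret S: subgroup G PGL2 by (rule G(1))
  define Orb where "Orb = (\<lambda>g. pgl_act g p) ` G"
  have p: "p \<in> Orb" unfolding Orb_def by (rule image_eqI[OF _ S.one_closed]) (simp add: pgl_act_one)
  have fin: "finite Orb" using G(2) by (simp add: Orb_def)
  have "D x = 1" if "x \<in> Orb" for x
    using that D(2,3) by (auto simp: Orb_def log_CY_pairs_def invariant_divisor_def)
  then have le: "card Orb \<le> 2"
    using card_coeff_one_le[OF _ D(1) fin] D(2) by (auto simp: log_CY_pairs_def)
  show ?thesis
  proof (cases "Orb = {p}")
    case True
    then have "pgl_act g p = p" if "g \<in> G" for g using that by (auto simp: Orb_def)
    then show ?thesis using cyclic_if_fixes_point[OF G] by blast
  next
    case False
    have "card Orb \<noteq> 0" using p fin by auto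
    moreover have "card Orb \<noteq> 1" using False p by (auto simp: card_1_singleton_iff)
    ultimately have "card Orb = 2" using le by linarith
    moreover have "pgl_act g x \<in> Orb" if "g \<in> G" "x \<in> Orb" for g x
    proof -
      obtain h where h: "h \<in> G" "x = pgl_act h p" using \<open>x \<in> Orb\<close> by (auto simp: Orb_def)
      then have "pgl_act g x = pgl_act (g \<otimes>\<^bsub>PGL2\<^esub> h) p" using \<open>g \<in> G\<close> by (simp add: pgl_act_mult)
      then show ?thesis unfolding Orb_def using h \<open>g \<in> G\<close> S.m_closed by blast
    qed
    ultimately show ?thesis by (rule cyclic_or_dihedral_if_invariant_pair[OF G])
  qed
qed

theorem proposition1:
  fixes G :: "('a :: {alg_closed_field, field_char_0} ^ 2 ^ 2) set set"
  assumes "subgroup G PGL2" and "finite G"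
  shows "(coreg G = 0 \<longleftrightarrow> cyclic_group (PGL2\<lparr>carrier := G\<rparr>) \<or> is_dihedral (PGL2\<lparr>carrier := G\<rparr>)) \<and>
    (\<not> (cyclic_group (PGL2\<lparr>carrier := G\<rparr>) \<or> is_dihedral (PGL2\<lparr>carrier := G\<rparr>)) \<longrightarrow> coreg G = 1)"
proof -
  let ?cd = "cyclic_group (PGL2\<lparr>carrier := G\<rparr>) \<or> is_dihedral (PGL2\<lparr>carrier := G\<rparr>)"
  let ?one = "\<exists>l\<ge>1. \<exists>D\<in>log_CY_pairs G l. \<exists>p. D p = 1"
  obtain l0 D0 where "l0 \<ge> 1" "D0 \<in> log_CY_pairs G l0"
    using log_CY_pair_exists[OF assms] by blast
  then have coreg: "coreg G = (if ?one then 0 else 1)" by (rule coreg_eq)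
  have "?one \<longleftrightarrow> ?cd"
  proof
    assume ?one
    then show ?cd using cyclic_or_dihedral_if_coeff_one[OF assms] by blast
  next
    assume ?cd
    from invariant_pair_if_cyclic_or_dihedral[OF assms this] obtain S :: "'a proj_line set"
      where S: "card S = 2" "\<And>g x. g \<in> G \<Longrightarrow> x \<in> S \<Longrightarrow> pgl_act g x \<in> S" by blast
    have "finite S" using S(1) by (auto intro: card_ge_0_finite)
    define D :: "'a proj_line \<Rightarrow> rat" where "D = (\<lambda>p. if p \<in> S then 2 / of_nat (card S) else 0)"
    have "D \<in> log_CY_pairs G (card S)"
      unfolding D_def using \<open>finite S\<close> S by (intro invariant_set_log_CY_pair[OF assms(1)]) auto
    moreover obtain p where "p \<in> S" using S(1) by fastforce
    then have "D p = 1" using S(1) by (simp add: D_def)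
    moreover have "card S \<ge> 1" using S(1) by simp
    ultimately show ?one by blast
  qed
  then show ?thesis using coreg by simp
qed

end
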